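(* Let $G=G_h$ be the group of hyperbolic rotations acting diagonally on $\mathbb R^6$, and put $\tau_1=x_1$, $\tau_2=y_1$, $\tau_3=y_1^2+y_2^2-y_3^2$, $\tau_6=x_3y_2-x_2y_3$. (a) The $G$-orbit of every point of $T\mathbb H^2$ is a branch of a hyperbola which lies in a two-dimensional affine subspace of $\mathbb R^6$. (b) The map $\Gamma:V\to\mathbb R^4$, $z\mapsto w=(w_1,w_2,w_3,w_4)^{\rm tr}=(\tau_1(z),\tau_2(z),\tau_3(z),\tau_6(z))^{\rm tr}$, sends $V$ to the variety $Y\subseteq\mathbb R^4$ defined by $$w_4^2=(w_1^2+1)w_3-w_2^2 .$$ (c) The image of $T\mathbb H^2$ under $\Gamma$ is equal to $Y$; hence $\Gamma(V)=Y$. (d) The Dirac-Poisson bracket $\{\cdot,\cdot\}^*$ on $V$ induces a Poisson bracket $\{\cdot,\cdot\}'$ on $Y$, which is determined by $$\{w_1,w_2\}'=1+w_1^2,\quad \{w_2,w_3\}'=2w_1w_3,\quad \{w_3,w_1\}'=-2w_2,$$ and $\{w_i,w_4\}'=0$ for $1\le i\le 3$. (e) For the Hamiltonian $H=\frac12\tau_3+U(\tau_1)$ with axisymmetric potential $U=U(x_1)$, $U$ a polynomial or rational function, the equations of motion on $T\mathbb H^2$, $$\dot x=y,\qquad \dot y=-\nabla_L^xU+x\left(\langle y,y\rangle_L-\langle x,\nabla_L^xU\rangle_L\right),$$ are mapped by $\Gamma$ to the reduced Hamiltonian system $$\dot w_1=\{w_1,h\}'=w_2,\quad \dot w_2=\{w_2,h\}'=w_1w_3-(1+w_1^2)U'(w_1),$$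 $$\dot w_3=\{w_3,h\}'=-2w_2U'(w_1),\quad \dot w_4=\{w_4,h\}'=0$$ on $Y$, with $h(w):=\frac12w_3+U(w_1)$. This system admits the first integrals $h$ and $w_4$.
   Context: Coordinates on $\mathbb R^6$ (identified with the tangent bundle $T\mathbb R^{2,1}$ of Minkowski space) are $(x,y)=(x_1,x_2,x_3,y_1,y_2,y_3)$. The Lorentz pseudo inner product is $\langle u,v\rangle_L=u_1v_1+u_2v_2-u_3v_3$, and $\nabla_L^xf=(\partial f/\partial x_1,\partial f/\partial x_2,-\partial f/\partial x_3)^{\rm tr}$. Put $$V=\{(x,y)\in\mathbb R^6:\langle x,x\rangle_L+1=0,\ \langle x,y\rangle_L=0\},\qquad T\mathbb H^2=\{(x,y)\in V: x_3>0\}.$$ For $A\in GL(3,\mathbb R)$ the diagonal action on $\mathbb R^6$ is $(x,y)\mapsto(Ax,Ay)$. The group $G_h$ of hyperbolic rotations consists of the matrices $\begin{pmatrix}1&0&0\\0&\cosh s&\sinh s\\0&\sinh s&\cosh s\end{pmatrix}$, $s\in\mathbb R$. For a real variety $Z$, $\mathbb R[Z]$ is the algebra of restrictions of polynomials to $Z$; a Poisson bracket on $Z$ is a skew-symmetric bilinear map $\mathbb R[Z]\times\mathbb R[Z]\to\mathbb R[Z]$ satisfying the Leibniz rule and the Jacobi identity. The Dirac-Poisson bracket $\{\cdot,\cdot\}^*$ on $V$ is the Poisson bracket determined by $\{x_i,x_j\}^*=0$, $\{x_i,y_j\}^*=g_{ij}+x_ix_j$, $\{y_i,y_j\}^*=x_iy_j-x_jy_i$,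 where $(g_{ij})={\rm diag}(1,1,-1)$. That it "induces" a bracket $\{\cdot,\cdot\}'$ on $Y$ means that $\{\cdot,\cdot\}'$ is a Poisson bracket on $Y$ with $\{\phi\circ\Gamma,\psi\circ\Gamma\}^*=\{\phi,\psi\}'\circ\Gamma$ for all $\phi,\psi\in\mathbb R[Y]$. For rational (or smooth) $h$ the bracket $\{w_i,h\}'=\sum_j\{w_i,w_j\}'\,\partial h/\partial w_j$ is used where $h$ is defined. "Mapped by $\Gamma$" means that $\Gamma$ maps parameterized solutions to parameterized solutions. *)

theory Defs
  imports "HOL-Analysis.Analysis" "HOL-Computational_Algebra.Polynomial"
begin

section \<open>Poisson algebras of real varieties\<close>

text \<open>\<open>\<real>[Z]\<close>: restrictions to \<open>Z\<close> of polynomials. Elements are extensional functions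
  (\<open>undefined\<close> outside \<open>Z\<close>), so that two polynomials agreeing on \<open>Z\<close> give the same element.\<close>

definition coord_ring :: "'a::euclidean_space set \<Rightarrow> ('a \<Rightarrow> real) set" where
  "coord_ring Z = {restrict p Z |p. real_polynomial_function p}"

definition coord :: "'a::euclidean_space set \<Rightarrow> 'a \<Rightarrow> 'a \<Rightarrow> real" where
  "coord Z b = (\<lambda>z\<in>Z. z \<bullet> b)"

text \<open>Linearity and the Leibniz rule in the second argument follow from skew-symmetry.
  Since brackets are extensional, equality of brackets is equality of maps on
  \<open>\<real>[Z] \<times> \<real>[Z]\<close>.\<close>

definition poisson_bracket ::
  "'a::euclidean_space set \<Rightarrow> (('a \<Rightarrow> real) \<Rightarrow> ('a \<Rightarrow> real) \<Rightarrow> ('a \<Rightarrow> real)) \<Rightarrow> bool" where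
  "poisson_bracket Z B \<longleftrightarrow>
     B \<in> coord_ring Z \<rightarrow>\<^sub>E (coord_ring Z \<rightarrow>\<^sub>E coord_ring Z) \<and>
     (\<forall>f\<in>coord_ring Z. \<forall>g\<in>coord_ring Z. \<forall>z\<in>Z. B f g z = - B g f z) \<and>
     (\<forall>f\<in>coord_ring Z. \<forall>g\<in>coord_ring Z. \<forall>k\<in>coord_ring Z. \<forall>a b. \<forall>z\<in>Z.
        B (\<lambda>z\<in>Z. a * f z + b * g z) k z = a * B f k z + b * B g k z) \<and>
     (\<forall>f\<in>coord_ring Z. \<forall>g\<in>coord_ring Z. \<forall>k\<in>coord_ring Z. \<forall>z\<in>Z.
        B (\<lambda>z\<in>Z. f z * g z) k z = f z * B g k z + g z * B f k z) \<and>
     (\<forall>f\<in>coord_ring Z. \<forall>g\<in>coord_ring Z. \<forall>k\<in>coord_ring Z. \<forall>z\<in>Z.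
        B f (B g k) z + B g (B k f) z + B k (B f g) z = 0)"

text \<open>\<open>P\<close> on \<open>Y\<close> is induced by \<open>B\<close> on \<open>Z\<close> via \<open>\<Gamma> : Z \<rightarrow> Y\<close>;
  \<open>compose Z \<phi> \<Gamma>\<close> is \<open>\<phi> \<circ> \<Gamma>\<close> as a function on \<open>Z\<close>.\<close>

definition induced_bracket ::
  "'a::euclidean_space set \<Rightarrow> (('a \<Rightarrow> real) \<Rightarrow> ('a \<Rightarrow> real) \<Rightarrow> ('a \<Rightarrow> real)) \<Rightarrow> ('a \<Rightarrow> 'b) \<Rightarrow>
   'b::euclidean_space set \<Rightarrow> (('b \<Rightarrow> real) \<Rightarrow> ('b \<Rightarrow> real) \<Rightarrow> ('b \<Rightarrow> real)) \<Rightarrow> bool" where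
  "induced_bracket Z B \<Gamma> Y P \<longleftrightarrow>
     poisson_bracket Y P \<and>
     (\<forall>\<phi>\<in>coord_ring Y. \<forall>\<psi>\<in>coord_ring Y.
        B (compose Z \<phi> \<Gamma>) (compose Z \<psi> \<Gamma>) = compose Z (P \<phi> \<psi>) \<Gamma>)"

text \<open>\<open>{f, h} = \<Sum>\<^sub>j {f, w\<^sub>j} \<partial>h/\<partial>w\<^sub>j\<close> for \<open>f\<close> in \<open>\<real>[Z]\<close> and \<open>h\<close> differentiable at the
  point considered.\<close>

definition smooth_bracket ::
  "'a::euclidean_space set \<Rightarrow> (('a \<Rightarrow> real) \<Rightarrow> ('a \<Rightarrow> real) \<Rightarrow> ('a \<Rightarrow> real)) \<Rightarrow>
   ('a \<Rightarrow> real) \<Rightarrow> ('a \<Rightarrow> real) \<Rightarrow> 'a \<Rightarrow> real" where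
  "smooth_bracket Z B f h z = (\<Sum>b\<in>Basis. B f (coord Z b) z * frechet_derivative h (at z) b)"

definition hamiltonian_field ::
  "'a::euclidean_space set \<Rightarrow> (('a \<Rightarrow> real) \<Rightarrow> ('a \<Rightarrow> real) \<Rightarrow> ('a \<Rightarrow> real)) \<Rightarrow>
   ('a \<Rightarrow> real) \<Rightarrow> 'a \<Rightarrow> 'a" where
  "hamiltonian_field Z B h z = (\<Sum>b\<in>Basis. smooth_bracket Z B (coord Z b) h z *\<^sub>R b)"

definition solution_on ::
  "('a::real_normed_vector \<Rightarrow> 'a) \<Rightarrow> 'a set \<Rightarrow> real set \<Rightarrow> (real \<Rightarrow> 'a) \<Rightarrow> bool" where
  "solution_on F M T c \<longleftrightarrow> open T \<and> is_interval T \<and>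
     (\<forall>t\<in>T. c t \<in> M \<and> (c has_vector_derivative F (c t)) (at t))"

definition first_integral ::
  "('a::real_normed_vector \<Rightarrow> 'a) \<Rightarrow> 'a set \<Rightarrow> ('a \<Rightarrow> real) \<Rightarrow> bool" where
  "first_integral F M I \<longleftrightarrow> (\<forall>T c. solution_on F M T c \<longrightarrow> (I \<circ> c) constant_on T)"


section \<open>Hyperbolas\<close>

text \<open>Normal form with respect to a Cartesian (orthonormal) frame \<open>e\<^sub>1, e\<^sub>2\<close> of the plane of
  the hyperbola, with centre \<open>c\<close>. The branches of a hyperbola are its connected components.\<close>

definition hyperbola :: "'a::euclidean_space set \<Rightarrow> bool" where
  "hyperbola C \<longleftrightarrow> (\<exists>c e\<^sub>1 e\<^sub>2 \<alpha> \<beta>.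
     norm e\<^sub>1 = 1 \<and> norm e\<^sub>2 = 1 \<and> e\<^sub>1 \<bullet> e\<^sub>2 = 0 \<and> \<alpha> > 0 \<and> \<beta> > 0 \<and>
     C = {c + u *\<^sub>R e\<^sub>1 + v *\<^sub>R e\<^sub>2 |u v. u\<^sup>2 / \<alpha>\<^sup>2 - v\<^sup>2 / \<beta>\<^sup>2 = 1})"


section \<open>The tangent bundle of the hyperbolic plane\<close>

type_synonym R6 = "(real^3) \<times> (real^3)"

definition lorentz :: "real^3 \<Rightarrow> real^3 \<Rightarrow> real" where
  "lorentz u v = u$1 * v$1 + u$2 * v$2 - u$3 * v$3"

definition lorentz_metric :: "3 \<Rightarrow> 3 \<Rightarrow> real" where
  "lorentz_metric i j = (if i = j then (if i = 3 then -1 else 1) else 0)"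

definition lorentz_gradient :: "(real^3 \<Rightarrow> real) \<Rightarrow> real^3 \<Rightarrow> real^3" where
  "lorentz_gradient f x =
     (\<chi> i. lorentz_metric i i * frechet_derivative f (at x) (axis i 1))"

definition VH :: "R6 set" where
  "VH = {(x, y). lorentz x x + 1 = 0 \<and> lorentz x y = 0}"

definition TH2 :: "R6 set" where
  "TH2 = {(x, y) \<in> VH. x$3 > 0}"

definition hyp_rot :: "real \<Rightarrow> real^3^3" where
  "hyp_rot s = vector [vector [1, 0, 0],
                       vector [0, cosh s, sinh s],
                       vector [0, sinh s, cosh s]]"

definition G_h :: "(real^3^3) set" where
  "G_h = range hyp_rot"

definition diag_act :: "real^3^3 \<Rightarrow> R6 \<Rightarrow> R6" where
  "diag_act A z = (A *v fst z, A *v snd z)"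

definition orbit_h :: "R6 \<Rightarrow> R6 set" where
  "orbit_h z = (\<lambda>A. diag_act A z) ` G_h"

abbreviation xcoord :: "3 \<Rightarrow> R6 \<Rightarrow> real" where
  "xcoord i \<equiv> coord VH (axis i 1, 0)"

abbreviation ycoord :: "3 \<Rightarrow> R6 \<Rightarrow> real" where
  "ycoord i \<equiv> coord VH (0, axis i 1)"

text \<open>The coordinates generate \<open>\<real>[VH]\<close>, so a Poisson bracket with these values is unique.\<close>

definition dirac_bracket ::
  "(R6 \<Rightarrow> real) \<Rightarrow> (R6 \<Rightarrow> real) \<Rightarrow> (R6 \<Rightarrow> real)" where
  "dirac_bracket = (THE D. poisson_bracket VH D \<and>
     (\<forall>(x, y)\<in>VH. \<forall>i j.
        D (xcoord i) (xcoord j) (x, y) = 0 \<and>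
        D (xcoord i) (ycoord j) (x, y) = lorentz_metric i j + x$i * x$j \<and>
        D (ycoord i) (ycoord j) (x, y) = x$i * y$j - x$j * y$i))"

definition tau1 :: "R6 \<Rightarrow> real" where
  "tau1 = (\<lambda>(x, y). x$1)"

definition tau2 :: "R6 \<Rightarrow> real" where
  "tau2 = (\<lambda>(x, y). y$1)"

definition tau3 :: "R6 \<Rightarrow> real" where
  "tau3 = (\<lambda>(x, y). (y$1)\<^sup>2 + (y$2)\<^sup>2 - (y$3)\<^sup>2)"

definition tau6 :: "R6 \<Rightarrow> real" where
  "tau6 = (\<lambda>(x, y). x$3 * y$2 - x$2 * y$3)"

definition Gam :: "R6 \<Rightarrow> real^4" where
  "Gam z = vector [tau1 z, tau2 z, tau3 z, tau6 z]"

definition YH :: "(real^4) set" where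
  "YH = {w. (w$4)\<^sup>2 = ((w$1)\<^sup>2 + 1) * w$3 - (w$2)\<^sup>2}"

abbreviation wcoord :: "4 \<Rightarrow> real^4 \<Rightarrow> real" where
  "wcoord i \<equiv> coord YH (axis i 1)"

definition reduced_relations ::
  "((real^4 \<Rightarrow> real) \<Rightarrow> (real^4 \<Rightarrow> real) \<Rightarrow> (real^4 \<Rightarrow> real)) \<Rightarrow> bool" where
  "reduced_relations P \<longleftrightarrow> (\<forall>w\<in>YH.
     P (wcoord 1) (wcoord 2) w = 1 + (w$1)\<^sup>2 \<and>
     P (wcoord 2) (wcoord 3) w = 2 * w$1 * w$3 \<and>
     P (wcoord 3) (wcoord 1) w = - 2 * w$2 \<and>
     P (wcoord 1) (wcoord 4) w = 0 \<and>
     P (wcoord 2) (wcoord 4) w = 0 \<and>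
     P (wcoord 3) (wcoord 4) w = 0)"

text \<open>The rational function \<open>p / q\<close> (a polynomial for \<open>q = 1\<close>) and its domain.\<close>

definition rat_fun :: "real poly \<Rightarrow> real poly \<Rightarrow> real \<Rightarrow> real" where
  "rat_fun p q t = poly p t / poly q t"

definition rat_dom :: "real poly \<Rightarrow> real set" where
  "rat_dom q = {t. poly q t \<noteq> 0}"

definition H_full :: "(real \<Rightarrow> real) \<Rightarrow> R6 \<Rightarrow> real" where
  "H_full U z = 1/2 * tau3 z + U (tau1 z)"

definition h_red :: "(real \<Rightarrow> real) \<Rightarrow> real^4 \<Rightarrow> real" where
  "h_red U w = 1/2 * w$3 + U (w$1)"

definition motion_field :: "(real \<Rightarrow> real) \<Rightarrow> R6 \<Rightarrow> R6" where
  "motion_field U = (\<lambda>(x, y).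
     let grad = lorentz_gradient (\<lambda>x. U (x$1)) x
     in (y, - grad + (lorentz y y - lorentz x grad) *\<^sub>R x))"

end

theory Submission
  imports Defs
begin

text \<open>A bracket on \<open>\<real>[Z]\<close> is a derivation in each argument, so it is known as soon as its values
  on coordinate functions are known (\<open>poisson_chain\<close>, \<open>poisson_bracket_unique\<close>). Conversely, prescribed
  values define a bracket on \<open>Z\<close> if the Hamiltonian vector fields of the coordinates are tangent to \<open>Z\<close>
  in the sense that they annihilate, on \<open>Z\<close>, every polynomial vanishing on \<open>Z\<close>; the Jacobi identity
  then only has to be checked on coordinates, because the Jacobiator is again a derivation in each
  argument (locale \<open>hamiltonian_fields\<close>). For the Dirac-Poisson bracket the fields are given by the
  closed formula \<open>dirac_field\<close>, bilinear in gradients; tangency is proved by running an explicit curve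
  inside \<open>VH\<close> in any prescribed tangent direction (\<open>der_tangent_VH\<close>). An arbitrary
  polynomial vanishing on \<open>VH\<close> is thereby covered, without knowing that it is a combination of the
  two defining equations.

  The components of \<open>Gam\<close> are invariants, and the Dirac-Poisson brackets of any two of them are
  polynomials in the four components (\<open>dirac_field_Gam_grad\<close>). As \<open>Gam\<close> maps \<open>VH\<close> onto \<open>YH\<close>, pullback
  along \<open>Gam\<close> is injective and its range is closed under the bracket, so the bracket descends, and all
  axioms hold downstairs because they hold upstairs (\<open>induced_bracket_ex1\<close>).

  The field of motion is the Hamiltonian field of \<open>H = h \<circ> Gam\<close>. The derivative of the \<open>i\<close>-th component
  of \<open>Gam\<close> along it is the bracket of that component with \<open>H\<close>, hence the corresponding reduced bracket
  with \<open>h\<close>; this gives the reduced system, along which \<open>h\<close> and the fourth coordinate have derivative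
  zero.

  An orbit is \<open>c + e\<^sup>s u + e\<^sup>-\<^sup>s v\<close> where \<open>u\<close> and \<open>v\<close> consist of multiples of the two null eigenvectors of
  the hyperbolic rotations. These are Euclidean-orthogonal, so the orbit is a branch of a rectangular
  hyperbola with asymptotic directions \<open>u\<close> and \<open>v\<close>, nondegenerate because \<open>x\<^sub>3 > \<bar>x\<^sub>2\<bar>\<close> on \<open>TH2\<close>.\<close>

section \<open>Directional derivatives of polynomial functions\<close>

abbreviation der :: "('a::real_normed_vector \<Rightarrow> real) \<Rightarrow> 'a \<Rightarrow> 'a \<Rightarrow> real" where
  "der p z v \<equiv> frechet_derivative p (at z) v"

lemma der_eqI: "(p has_derivative p') (at z) \<Longrightarrow> der p z v = p' v"
  using frechet_derivative_at by metis

lemma has_derivative_der: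
  "real_polynomial_function p \<Longrightarrow> (p has_derivative der p z) (at z)"
  using differentiable_at_real_polynomial_function frechet_derivative_works by blast

text \<open>Polynomial functions are generated from arbitrary bounded linear functionals; a functional is a
  combination of the finitely many coordinates, so two derivations need only be compared on those.\<close>

lemma polynomial_coordinate_induct [consumes 1, case_names coordinate const add mult]:
  fixes p :: "'a::euclidean_space \<Rightarrow> real"
  assumes "real_polynomial_function p"
    and coordinate: "\<And>b. b \<in> Basis \<Longrightarrow> P (\<lambda>z. z \<bullet> b)"
    and const: "\<And>c. P (\<lambda>z. c)"
    and add: "\<And>p q. real_polynomial_function p \<Longrightarrow> real_polynomial_function q \<Longrightarrow>
      P p \<Longrightarrow> P q \<Longrightarrow> P (\<lambda>z. p z + q z)"
    and mult: "\<And>p q. real_polynomial_function p \<Longrightarrow> real_polynomial_function q \<Longrightarrow>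
      P p \<Longrightarrow> P q \<Longrightarrow> P (\<lambda>z. p z * q z)"
  shows "P p"
  using assms(1)
proof induction
  case (linear f)
  have coord_poly: "real_polynomial_function (\<lambda>z::'a. z \<bullet> b)" for b
    by (rule real_polynomial_function.intros(1)) (rule bounded_linear_inner_left)
  have "P (\<lambda>z. \<Sum>b\<in>S. f b * (z \<bullet> b))" if "S \<subseteq> Basis" for S
    using finite_subset[OF that finite_Basis] that
  proof (induction S)
    case empty
    then show ?case using const[of 0] by simp
  next
    case (insert b S)
    have "P (\<lambda>z. f b * (z \<bullet> b) + (\<Sum>b\<in>S. f b * (z \<bullet> b)))"
      using insert coord_poly
      by (intro add mult const coordinate)
        (auto intro!: real_polynomial_function_sum real_polynomial_function.intros(2,4))
    then show ?case using insert by simp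
  qed
  moreover have "f = (\<lambda>z. \<Sum>b\<in>Basis. f b * (z \<bullet> b))"
  proof
    fix z
    have "f z = f (\<Sum>b\<in>Basis. (z \<bullet> b) *\<^sub>R b)" by (simp add: euclidean_representation)
    also have "\<dots> = (\<Sum>b\<in>Basis. f b * (z \<bullet> b))"
      using linear by (simp add: linear_sum linear_cmul bounded_linear.linear mult.commute)
    finally show "f z = (\<Sum>b\<in>Basis. f b * (z \<bullet> b))" .
  qed
  ultimately show ?case by (metis order_refl)
qed (use const add mult in auto)

lemma der_inner [simp]: "der (\<lambda>z::'a::euclidean_space. z \<bullet> b) z v = v \<bullet> b"
  by (rule der_eqI) (auto intro!: derivative_eq_intros)

lemma der_const [simp]: "der (\<lambda>z::'a::real_normed_vector. c) z v = 0"
  by (rule der_eqI) (auto intro!: derivative_eq_intros)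

lemma der_add:
  assumes "real_polynomial_function p" "real_polynomial_function q"
  shows "der (\<lambda>z. p z + q z) z v = der p z v + der q z v"
  by (rule der_eqI[OF has_derivative_add]; intro has_derivative_der assms)

lemma der_mult:
  assumes "real_polynomial_function p" "real_polynomial_function q"
  shows "der (\<lambda>z. p z * q z) z v = p z * der q z v + q z * der p z v"
  using der_eqI[OF has_derivative_mult[OF has_derivative_der[OF assms(1)] has_derivative_der[OF assms(2)]]]
  by (simp add: mult.commute)

lemma der_linear: "real_polynomial_function p \<Longrightarrow> linear (der p z)"
  using has_derivative_der has_derivative_linear by blast

lemma der_expand:
  fixes p :: "'a::euclidean_space \<Rightarrow> real"
  assumes "real_polynomial_function p"
  shows "der p z v = (\<Sum>c\<in>Basis. (v \<bullet> c) * der p z c)"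
proof -
  have "der p z v = der p z (\<Sum>c\<in>Basis. (v \<bullet> c) *\<^sub>R c)" by (simp add: euclidean_representation)
  also have "\<dots> = (\<Sum>c\<in>Basis. (v \<bullet> c) * der p z c)"
    using der_linear[OF assms] by (simp add: linear_sum linear_cmul)
  finally show ?thesis .
qed

lemma polynomial_inner:
  fixes X :: "'a::real_normed_vector \<Rightarrow> 'b::euclidean_space"
  shows "polynomial_function X \<Longrightarrow> real_polynomial_function (\<lambda>z. X z \<bullet> b)"
  by (simp add: real_polynomial_function_eq polynomial_function_inner)

lemma polynomial_coordinate: "real_polynomial_function (\<lambda>z::'a::euclidean_space. z \<bullet> b)"
  by (intro polynomial_inner) simp

lemma polynomial_lincomb:
  "real_polynomial_function p \<Longrightarrow> real_polynomial_function q \<Longrightarrow>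
    real_polynomial_function (\<lambda>z. a * p z + b * q z)"
  by (intro real_polynomial_function.intros(2,3,4))

lemma polynomial_der:
  fixes p :: "'a::euclidean_space \<Rightarrow> real"
  assumes "real_polynomial_function p"
  shows "real_polynomial_function (\<lambda>z. der p z v)"
  using assms
proof (induction rule: polynomial_coordinate_induct)
  case (mult p q)
  then show ?case
    by (auto simp: der_mult intro!: real_polynomial_function.intros(3,4))
qed (auto simp: der_add)

lemma polynomial_der_field:
  fixes p :: "'a::euclidean_space \<Rightarrow> real"
  assumes "real_polynomial_function p" "polynomial_function X"
  shows "real_polynomial_function (\<lambda>z. der p z (X z))"
  unfolding der_expand[OF assms(1), of _ "X _"]
  by (intro real_polynomial_function_sum finite_Basis real_polynomial_function.intros(4)
      polynomial_inner polynomial_der assms)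

section \<open>Poisson brackets are determined by the coordinates\<close>

lemma restrict_in_coord_ring:
  "real_polynomial_function p \<Longrightarrow> restrict p Z \<in> coord_ring Z"
  unfolding coord_ring_def by blast

lemma coord_ring_cases:
  assumes "f \<in> coord_ring Z"
  obtains p where "real_polynomial_function p" "f = restrict p Z"
  using assms unfolding coord_ring_def by blast

lemma coord_ring_eqI:
  assumes "f \<in> coord_ring Z" "g \<in> coord_ring Z" "\<And>z. z \<in> Z \<Longrightarrow> f z = g z"
  shows "f = g"
  using assms unfolding coord_ring_def by (auto simp: fun_eq_iff restrict_def)

lemma poisson_closed:
  assumes "poisson_bracket Z B" "f \<in> coord_ring Z" "g \<in> coord_ring Z"
  shows "B f g \<in> coord_ring Z"
  using assms unfolding poisson_bracket_def by (auto simp: PiE_def Pi_def)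

lemma poisson_skew:
  assumes "poisson_bracket Z B" "f \<in> coord_ring Z" "g \<in> coord_ring Z" "z \<in> Z"
  shows "B f g z = - B g f z"
  using assms unfolding poisson_bracket_def by blast

lemma poisson_linear:
  assumes "poisson_bracket Z B" "f \<in> coord_ring Z" "g \<in> coord_ring Z" "k \<in> coord_ring Z" "z \<in> Z"
  shows "B (\<lambda>z\<in>Z. a * f z + b * g z) k z = a * B f k z + b * B g k z"
  using assms unfolding poisson_bracket_def by blast

lemma poisson_leibniz:
  assumes "poisson_bracket Z B" "f \<in> coord_ring Z" "g \<in> coord_ring Z" "k \<in> coord_ring Z" "z \<in> Z"
  shows "B (\<lambda>z\<in>Z. f z * g z) k z = f z * B g k z + g z * B f k z"
  using assms unfolding poisson_bracket_def by blast

lemma poisson_jacobi: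
  assumes "poisson_bracket Z B" "f \<in> coord_ring Z" "g \<in> coord_ring Z" "k \<in> coord_ring Z" "z \<in> Z"
  shows "B f (B g k) z + B g (B k f) z + B k (B f g) z = 0"
  using assms unfolding poisson_bracket_def by blast

lemma poisson_add:
  assumes "poisson_bracket Z B" "real_polynomial_function p" "real_polynomial_function q"
    "k \<in> coord_ring Z" "z \<in> Z"
  shows "B (\<lambda>z\<in>Z. p z + q z) k z = B (restrict p Z) k z + B (restrict q Z) k z"
proof -
  have "(\<lambda>z\<in>Z. p z + q z) = (\<lambda>z\<in>Z. 1 * restrict p Z z + 1 * restrict q Z z)" by auto
  then show ?thesis
    using poisson_linear[OF assms(1) restrict_in_coord_ring[OF assms(2)]
      restrict_in_coord_ring[OF assms(3)] assms(4,5), of 1 1] by simp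
qed

lemma poisson_mult:
  assumes "poisson_bracket Z B" "real_polynomial_function p" "real_polynomial_function q"
    "k \<in> coord_ring Z" "z \<in> Z"
  shows "B (\<lambda>z\<in>Z. p z * q z) k z = p z * B (restrict q Z) k z + q z * B (restrict p Z) k z"
proof -
  have "(\<lambda>z\<in>Z. p z * q z) = (\<lambda>z\<in>Z. restrict p Z z * restrict q Z z)" by auto
  then show ?thesis
    using poisson_leibniz[OF assms(1) restrict_in_coord_ring[OF assms(2)]
      restrict_in_coord_ring[OF assms(3)] assms(4,5)] assms(5) by simp
qed

text \<open>The Leibniz rule for \<open>1 = 1 \<cdot> 1\<close> gives \<open>{1, k} = 2 {1, k}\<close>.\<close>

lemma poisson_const:
  assumes "poisson_bracket Z B" "k \<in> coord_ring Z" "z \<in> Z"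
  shows "B (\<lambda>z\<in>Z. c) k z = 0"
proof -
  have 1: "B (\<lambda>z\<in>Z. 1) k z = 0"
    using poisson_mult[OF assms(1) real_polynomial_function.intros(2) real_polynomial_function.intros(2)
      assms(2,3), of 1 1] by simp
  have "(\<lambda>z\<in>Z. c) = (\<lambda>z\<in>Z. c * (\<lambda>z\<in>Z. 1) z + 0 * (\<lambda>z\<in>Z. 1) z)" by auto
  then show ?thesis
    using poisson_linear[OF assms(1) restrict_in_coord_ring restrict_in_coord_ring assms(2,3),
      of "\<lambda>z. 1" "\<lambda>z. 1" c 0] 1 by auto
qed

text \<open>Both sides are derivations in \<open>\<phi>\<close> over evaluation at \<open>\<Gamma> z\<close>, and they agree on coordinates.\<close>

lemma poisson_chain_left:
  fixes \<Gamma> :: "'a::euclidean_space \<Rightarrow> 'b::euclidean_space"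
  assumes B: "poisson_bracket Z B" and \<Gamma>: "polynomial_function \<Gamma>"
    and \<phi>: "real_polynomial_function \<phi>" and k: "k \<in> coord_ring Z" and z: "z \<in> Z"
  shows "B (\<lambda>z\<in>Z. \<phi> (\<Gamma> z)) k z = (\<Sum>b\<in>Basis. der \<phi> (\<Gamma> z) b * B (\<lambda>z\<in>Z. \<Gamma> z \<bullet> b) k z)"
  using \<phi>
proof (induction rule: polynomial_coordinate_induct)
  case (coordinate b)
  then show ?case by (simp add: inner_Basis if_distrib[of "\<lambda>x. x * _"] cong: if_cong)
next
  case (const c)
  then show ?case using poisson_const[OF B k z] by (simp only: der_const) simp
next
  case (add p q)
  then have "real_polynomial_function (\<lambda>z. p (\<Gamma> z))" "real_polynomial_function (\<lambda>z. q (\<Gamma> z))"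
    using real_polynomial_function_compose[OF \<Gamma>] by (auto simp: o_def)
  from poisson_add[OF B this k z] add show ?case
    by (simp add: der_add sum.distrib algebra_simps del: restrict_apply)
next
  case (mult p q)
  then have "real_polynomial_function (\<lambda>z. p (\<Gamma> z))" "real_polynomial_function (\<lambda>z. q (\<Gamma> z))"
    using real_polynomial_function_compose[OF \<Gamma>] by (auto simp: o_def)
  from poisson_mult[OF B this k z] mult show ?case
    by (simp add: der_mult sum.distrib sum_distrib_left algebra_simps del: restrict_apply)
qed

text \<open>With \<open>\<Gamma>\<close> the identity this expresses a bracket by its values on coordinates; with a general
  \<open>\<Gamma>\<close> it shows which brackets must be known for the bracket to descend along \<open>\<Gamma>\<close>.\<close>

lemma poisson_chain:
  fixes \<Gamma> :: "'a::euclidean_space \<Rightarrow> 'b::euclidean_space"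
  assumes B: "poisson_bracket Z B" and \<Gamma>: "polynomial_function \<Gamma>"
    and \<phi>: "real_polynomial_function \<phi>" and \<psi>: "real_polynomial_function \<psi>" and z: "z \<in> Z"
  shows "B (\<lambda>z\<in>Z. \<phi> (\<Gamma> z)) (\<lambda>z\<in>Z. \<psi> (\<Gamma> z)) z =
    (\<Sum>b\<in>Basis. \<Sum>c\<in>Basis. der \<phi> (\<Gamma> z) b * der \<psi> (\<Gamma> z) c *
       B (\<lambda>z\<in>Z. \<Gamma> z \<bullet> b) (\<lambda>z\<in>Z. \<Gamma> z \<bullet> c) z)"
proof -
  have \<psi>\<Gamma>: "(\<lambda>z\<in>Z. \<psi> (\<Gamma> z)) \<in> coord_ring Z"
    using real_polynomial_function_compose[OF \<Gamma> \<psi>]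
    by (auto simp: o_def intro: restrict_in_coord_ring)
  have \<Gamma>b: "(\<lambda>z\<in>Z. \<Gamma> z \<bullet> b) \<in> coord_ring Z" for b
    by (intro restrict_in_coord_ring polynomial_inner \<Gamma>)
  have "B (\<lambda>z\<in>Z. \<Gamma> z \<bullet> b) (\<lambda>z\<in>Z. \<psi> (\<Gamma> z)) z =
      (\<Sum>c\<in>Basis. der \<psi> (\<Gamma> z) c * B (\<lambda>z\<in>Z. \<Gamma> z \<bullet> b) (\<lambda>z\<in>Z. \<Gamma> z \<bullet> c) z)" for b
    by (simp add: poisson_skew[OF B \<Gamma>b \<psi>\<Gamma> z] poisson_skew[OF B \<Gamma>b[of b] \<Gamma>b z]
        poisson_chain_left[OF B \<Gamma> \<psi> \<Gamma>b z] sum_negf)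
  then show ?thesis
    using poisson_chain_left[OF B \<Gamma> \<phi> \<psi>\<Gamma> z] by (simp add: sum_distrib_left algebra_simps)
qed

lemma poisson_by_coordinates:
  assumes B: "poisson_bracket Z B"
    and p: "real_polynomial_function p" and q: "real_polynomial_function q" and z: "z \<in> Z"
  shows "B (restrict p Z) (restrict q Z) z =
    (\<Sum>b\<in>Basis. \<Sum>c\<in>Basis. der p z b * der q z c * B (coord Z b) (coord Z c) z)"
  using poisson_chain[OF B polynomial_function_id p q z]
  by (simp add: coord_def)

lemma poisson_bracket_unique:
  assumes B: "poisson_bracket Z B" and B': "poisson_bracket Z B'"
    and eq: "\<And>b c z. b \<in> Basis \<Longrightarrow> c \<in> Basis \<Longrightarrow> z \<in> Z \<Longrightarrow>
      B (coord Z b) (coord Z c) z = B' (coord Z b) (coord Z c) z"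
  shows "B = B'"
proof -
  have *: "B \<in> coord_ring Z \<rightarrow>\<^sub>E (coord_ring Z \<rightarrow>\<^sub>E coord_ring Z)"
    "B' \<in> coord_ring Z \<rightarrow>\<^sub>E (coord_ring Z \<rightarrow>\<^sub>E coord_ring Z)"
    using B B' unfolding poisson_bracket_def by auto
  have "B f g = B' f g" if f: "f \<in> coord_ring Z" and g: "g \<in> coord_ring Z" for f g
  proof (rule coord_ring_eqI)
    fix z assume z: "z \<in> Z"
    obtain p q where "real_polynomial_function p" "f = restrict p Z"
      "real_polynomial_function q" "g = restrict q Z"
      using f g by (metis coord_ring_cases)
    then show "B f g z = B' f g z"
      using poisson_by_coordinates[OF B _ _ z] poisson_by_coordinates[OF B' _ _ z] eq z
      by simp
  qed (use f g B B' poisson_closed in auto)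
  then have "B f = B' f" if "f \<in> coord_ring Z" for f
    using that * by (intro PiE_ext[of _ "coord_ring Z" "\<lambda>_. coord_ring Z"]) (auto simp: PiE_mem)
  then show ?thesis
    by (intro PiE_ext[OF *]) auto
qed

section \<open>Poisson brackets from Hamiltonian vector fields\<close>

text \<open>\<open>X b\<close> stands for the Hamiltonian field of the coordinate \<open>b\<close>, with \<open>X b z \<bullet> c = {b, c} z\<close>. The
  bracket is taken on polynomials of the ambient space and only later restricted to the variety.\<close>

definition hamiltonian_bracket ::
  "('a::euclidean_space \<Rightarrow> 'a \<Rightarrow> 'a) \<Rightarrow> ('a \<Rightarrow> real) \<Rightarrow> ('a \<Rightarrow> real) \<Rightarrow> 'a \<Rightarrow> real" where
  "hamiltonian_bracket X p q z = (\<Sum>b\<in>Basis. der p z b * der q z (X b z))"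

text \<open>Tangency is required for every polynomial vanishing on \<open>Z\<close> and not just for a set of defining
  equations, since these need not generate the vanishing ideal of a real variety.\<close>

locale hamiltonian_fields =
  fixes Z :: "'a::euclidean_space set" and X :: "'a \<Rightarrow> 'a \<Rightarrow> 'a"
  assumes polynomial: "\<And>b. b \<in> Basis \<Longrightarrow> polynomial_function (X b)"
    and skew: "\<And>b c z. b \<in> Basis \<Longrightarrow> c \<in> Basis \<Longrightarrow> X b z \<bullet> c = - (X c z \<bullet> b)"
    and jacobi: "\<And>a b c z. a \<in> Basis \<Longrightarrow> b \<in> Basis \<Longrightarrow> c \<in> Basis \<Longrightarrow> z \<in> Z \<Longrightarrow>
      der (\<lambda>z. X b z \<bullet> c) z (X a z) + der (\<lambda>z. X c z \<bullet> a) z (X b z)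
      + der (\<lambda>z. X a z \<bullet> b) z (X c z) = 0"
    and tangent: "\<And>p b z. real_polynomial_function p \<Longrightarrow> (\<And>z. z \<in> Z \<Longrightarrow> p z = 0) \<Longrightarrow>
      b \<in> Basis \<Longrightarrow> z \<in> Z \<Longrightarrow> der p z (X b z) = 0"
begin

abbreviation br :: "('a \<Rightarrow> real) \<Rightarrow> ('a \<Rightarrow> real) \<Rightarrow> 'a \<Rightarrow> real" where
  "br \<equiv> hamiltonian_bracket X"

lemma br_polynomial:
  assumes "real_polynomial_function p" "real_polynomial_function q"
  shows "real_polynomial_function (br p q)"
  unfolding hamiltonian_bracket_def
  by (intro real_polynomial_function_sum finite_Basis real_polynomial_function.intros(4)
      polynomial_der polynomial_der_field polynomial assms)

lemma br_skew:
  assumes p: "real_polynomial_function p" and q: "real_polynomial_function q"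
  shows "br p q z = - br q p z"
proof -
  have "br p q z = (\<Sum>b\<in>Basis. \<Sum>c\<in>Basis. der p z b * der q z c * (X b z \<bullet> c))"
    unfolding hamiltonian_bracket_def der_expand[OF q, of z "X _ z"]
    by (simp add: sum_distrib_left mult_ac)
  also have "\<dots> = (\<Sum>c\<in>Basis. \<Sum>b\<in>Basis. der p z b * der q z c * - (X c z \<bullet> b))"
    by (subst sum.swap) (intro sum.cong refl arg_cong2[where f="(*)"] skew)
  also have "\<dots> = - br q p z"
    unfolding hamiltonian_bracket_def der_expand[OF p, of z "X _ z"]
    by (simp add: sum_distrib_left mult_ac sum_negf)
  finally show ?thesis .
qed

lemma br_coordinate: "b \<in> Basis \<Longrightarrow> br (\<lambda>z. z \<bullet> b) q z = der q z (X b z)"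
  by (simp add: hamiltonian_bracket_def inner_Basis if_distrib[of "\<lambda>x. x * _"] cong: if_cong)

lemma br_add_right:
  assumes "real_polynomial_function q" "real_polynomial_function r"
  shows "br p (\<lambda>z. q z + r z) z = br p q z + br p r z"
  using assms by (simp add: hamiltonian_bracket_def der_add sum.distrib algebra_simps)

lemma br_mult_right:
  assumes "real_polynomial_function q" "real_polynomial_function r"
  shows "br p (\<lambda>z. q z * r z) z = q z * br p r z + r z * br p q z"
  using assms by (simp add: hamiltonian_bracket_def der_mult sum.distrib sum_distrib_left algebra_simps)

lemma br_add_left:
  assumes "real_polynomial_function q" "real_polynomial_function r"
  shows "br (\<lambda>z. q z + r z) p z = br q p z + br r p z"
  using assms by (simp add: hamiltonian_bracket_def der_add sum.distrib algebra_simps)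

lemma br_mult_left:
  assumes "real_polynomial_function q" "real_polynomial_function r"
  shows "br (\<lambda>z. q z * r z) p z = q z * br r p z + r z * br q p z"
  using assms by (simp add: hamiltonian_bracket_def der_mult sum.distrib sum_distrib_left algebra_simps)

lemma br_lincomb_left:
  assumes "real_polynomial_function q" "real_polynomial_function r"
  shows "br (\<lambda>z. a * q z + b * r z) p z = a * br q p z + b * br r p z"
proof -
  have "der (\<lambda>z. a * q z + b * r z) z v = a * der q z v + b * der r z v" for v
    by (rule der_eqI) (intro has_derivative_add has_derivative_mult_right has_derivative_der assms)
  then show ?thesis
    by (simp add: hamiltonian_bracket_def sum.distrib sum_distrib_left algebra_simps)
qed

lemma br_const [simp]: "br (\<lambda>z. c) p z = 0" "br p (\<lambda>z. c) z = 0"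
  by (simp_all add: hamiltonian_bracket_def)

definition jacobiator where
  "jacobiator p q r z = br p (br q r) z + br q (br r p) z + br r (br p q) z"

lemma jacobiator_cycle: "jacobiator p q r = jacobiator q r p"
  by (simp add: jacobiator_def fun_eq_iff)

text \<open>The Jacobiator is a derivation in its last argument: when the Leibniz rule is expanded on a product,
  the terms with two first-order brackets cancel by skew-symmetry.\<close>

lemma jacobiator_vanishes_right:
  assumes p: "real_polynomial_function p" and q: "real_polynomial_function q"
    and r: "real_polynomial_function r"
    and zero: "\<And>b. b \<in> Basis \<Longrightarrow> jacobiator p q (\<lambda>z. z \<bullet> b) z = 0"
  shows "jacobiator p q r z = 0"
  using r
proof (induction rule: polynomial_coordinate_induct)
  case (coordinate b)
  then show ?case by (rule zero)
next
  case (const c)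
  have "br (\<lambda>z. c) p = (\<lambda>z. 0)" "br q (\<lambda>z. c) = (\<lambda>z. 0)" by (simp_all add: fun_eq_iff)
  then show ?case by (simp add: jacobiator_def)
next
  case (add r s)
  note rs = add(1,2)
  have *: "br q (\<lambda>z. r z + s z) = (\<lambda>z. br q r z + br q s z)"
    "br (\<lambda>z. r z + s z) p = (\<lambda>z. br r p z + br s p z)"
    using br_add_right[OF rs] br_add_left[OF rs] by auto
  have "jacobiator p q (\<lambda>z. r z + s z) z = jacobiator p q r z + jacobiator p q s z"
    unfolding jacobiator_def *
    by (simp add: br_add_right br_add_left rs p q br_polynomial)
  then show ?case using add by simp
next
  case (mult r s)
  note rs = mult(1,2)
  have *: "br q (\<lambda>z. r z * s z) = (\<lambda>z. r z * br q s z + s z * br q r z)"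
    "br (\<lambda>z. r z * s z) p = (\<lambda>z. r z * br s p z + s z * br r p z)"
    using br_mult_right[OF rs] br_mult_left[OF rs] by auto
  have "jacobiator p q (\<lambda>z. r z * s z) z = r z * jacobiator p q s z + s z * jacobiator p q r z"
    unfolding jacobiator_def *
    by (simp add: br_add_right br_mult_right br_mult_left rs p q br_polynomial
        real_polynomial_function.intros(4) br_skew[OF rs(1) p, of z] br_skew[OF rs(2) p, of z] algebra_simps)
  then show ?case using mult by simp
qed

lemma jacobiator_coordinates:
  assumes "a \<in> Basis" "b \<in> Basis" "c \<in> Basis" "z \<in> Z"
  shows "jacobiator (\<lambda>z. z \<bullet> a) (\<lambda>z. z \<bullet> b) (\<lambda>z. z \<bullet> c) z = 0"
proof -
  have "br (\<lambda>z. z \<bullet> u) (\<lambda>z. z \<bullet> v) = (\<lambda>z. X u z \<bullet> v)" if "u \<in> Basis" for u v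
    using that by (simp add: br_coordinate fun_eq_iff)
  then show ?thesis
    using assms jacobi by (simp add: jacobiator_def br_coordinate)
qed

text \<open>The cyclic symmetry of the Jacobiator moves each argument in turn into the last place, where it can
  be reduced to coordinates.\<close>

lemma jacobiator_vanishes:
  assumes p: "real_polynomial_function p" and q: "real_polynomial_function q"
    and r: "real_polynomial_function r" and z: "z \<in> Z"
  shows "jacobiator p q r z = 0"
proof (rule jacobiator_vanishes_right[OF p q r])
  fix c :: 'a assume c: "c \<in> Basis"
  have "jacobiator (\<lambda>z. z \<bullet> c) p q z = 0"
  proof (rule jacobiator_vanishes_right[OF polynomial_coordinate p q])
    fix b :: 'a assume b: "b \<in> Basis"
    have "jacobiator (\<lambda>z. z \<bullet> b) (\<lambda>z. z \<bullet> c) p z = 0"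
      by (rule jacobiator_vanishes_right[OF polynomial_coordinate polynomial_coordinate p])
        (use jacobiator_coordinates[OF b c _ z] in simp)
    then show "jacobiator (\<lambda>z. z \<bullet> c) p (\<lambda>z. z \<bullet> b) z = 0"
      by (metis jacobiator_cycle)
  qed
  then show "jacobiator p q (\<lambda>z. z \<bullet> c) z = 0"
    by (metis jacobiator_cycle)
qed

lemma br_cong_right:
  assumes q: "real_polynomial_function q" and q': "real_polynomial_function q'"
    and eq: "restrict q Z = restrict q' Z" and z: "z \<in> Z"
  shows "br p q z = br p q' z"
proof -
  have diff: "real_polynomial_function (\<lambda>z. q z + - q' z)"
    by (intro real_polynomial_function.intros(3) real_polynomial_function_minus q q')
  have "br p (\<lambda>z. q z + - q' z) z = 0"
    unfolding hamiltonian_bracket_def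
    using tangent[OF diff _ _ z] eq by (auto simp: fun_eq_iff restrict_def intro!: sum.neutral split: if_splits)
  moreover have "br p (\<lambda>z. q z + (- 1) * q' z) z = br p q z + (- 1) * br p q' z"
    using q q' br_mult_right[OF real_polynomial_function.intros(2) q', of p "-1"]
    by (subst br_add_right) auto
  ultimately show ?thesis by simp
qed

text \<open>The ambient bracket passes to restrictions in the second argument by tangency, and hence in the
  first by skew-symmetry.\<close>

lemma br_cong:
  assumes "real_polynomial_function p" "real_polynomial_function p'"
    and "real_polynomial_function q" "real_polynomial_function q'"
    and "restrict p Z = restrict p' Z" "restrict q Z = restrict q' Z" and "z \<in> Z"
  shows "br p q z = br p' q' z"
  using br_cong_right[of q q' z p] br_cong_right[of p p' z q'] br_skew[of p q' z] br_skew[of p' q' z] assms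
  by simp

text \<open>By \<open>br_cong\<close> the choice of the extension does not affect the bracket below.\<close>

definition extend :: "('a \<Rightarrow> real) \<Rightarrow> 'a \<Rightarrow> real" where
  "extend f = (SOME p. real_polynomial_function p \<and> f = restrict p Z)"

definition bracket :: "('a \<Rightarrow> real) \<Rightarrow> ('a \<Rightarrow> real) \<Rightarrow> 'a \<Rightarrow> real" where
  "bracket = (\<lambda>f\<in>coord_ring Z. \<lambda>g\<in>coord_ring Z. restrict (br (extend f) (extend g)) Z)"

lemma extend:
  assumes "f \<in> coord_ring Z"
  shows "real_polynomial_function (extend f)" "f = restrict (extend f) Z"
proof -
  have "\<exists>p. real_polynomial_function p \<and> f = restrict p Z"
    using assms by (auto simp: coord_ring_def)
  from someI_ex[OF this] show "real_polynomial_function (extend f)" "f = restrict (extend f) Z"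
    unfolding extend_def by auto
qed

lemma bracket_restrict:
  assumes p: "real_polynomial_function p" and q: "real_polynomial_function q"
  shows "bracket (restrict p Z) (restrict q Z) = restrict (br p q) Z"
proof -
  have "br (extend (restrict p Z)) (extend (restrict q Z)) z = br p q z" if "z \<in> Z" for z
    using extend[OF restrict_in_coord_ring[OF p, of Z]] extend[OF restrict_in_coord_ring[OF q, of Z]]
      that p q by (intro br_cong) auto
  then show ?thesis
    by (auto simp: bracket_def restrict_in_coord_ring p q intro!: restrict_ext)
qed

lemma bracket_coord: "b \<in> Basis \<Longrightarrow> z \<in> Z \<Longrightarrow> bracket (coord Z b) (coord Z c) z = X b z \<bullet> c"
  unfolding coord_def by (simp add: bracket_restrict polynomial_coordinate br_coordinate)

lemma poisson_bracket_bracket: "poisson_bracket Z bracket"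
  unfolding poisson_bracket_def
proof (intro conjI ballI allI)
  show "bracket \<in> coord_ring Z \<rightarrow>\<^sub>E coord_ring Z \<rightarrow>\<^sub>E coord_ring Z"
    unfolding bracket_def
    by (auto intro!: restrict_in_coord_ring br_polynomial extend(1))
next
  fix f g z assume "f \<in> coord_ring Z" "g \<in> coord_ring Z" "z \<in> Z"
  then show "bracket f g z = - bracket g f z"
    by (elim coord_ring_cases) (simp add: bracket_restrict, rule br_skew)
next
  fix f g k a b z
  assume *: "f \<in> coord_ring Z" "g \<in> coord_ring Z" "k \<in> coord_ring Z" "z \<in> Z"
  from *(1-3) show "bracket (\<lambda>z\<in>Z. a * f z + b * g z) k z = a * bracket f k z + b * bracket g k z"
  proof (elim coord_ring_cases)
    fix p q r assume pqr: "real_polynomial_function p" "f = restrict p Z"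
      "real_polynomial_function q" "g = restrict q Z" "real_polynomial_function r" "k = restrict r Z"
    have "(\<lambda>z\<in>Z. a * f z + b * g z) = (\<lambda>z\<in>Z. a * p z + b * q z)" using pqr by auto
    then show ?thesis
      using pqr * by (simp add: bracket_restrict polynomial_lincomb br_lincomb_left
          del: restrict_apply) (simp add: br_lincomb_left)
  qed
next
  fix f g k z
  assume *: "f \<in> coord_ring Z" "g \<in> coord_ring Z" "k \<in> coord_ring Z" "z \<in> Z"
  from *(1-3) show "bracket (\<lambda>z\<in>Z. f z * g z) k z = f z * bracket g k z + g z * bracket f k z"
  proof (elim coord_ring_cases)
    fix p q r assume pqr: "real_polynomial_function p" "f = restrict p Z"
      "real_polynomial_function q" "g = restrict q Z" "real_polynomial_function r" "k = restrict r Z"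
    have "(\<lambda>z\<in>Z. f z * g z) = (\<lambda>z\<in>Z. p z * q z)" using pqr by auto
    then show ?thesis
      using pqr * by (simp add: bracket_restrict real_polynomial_function.intros(4)
          del: restrict_apply) (simp add: br_mult_left)
  qed
next
  fix f g k z
  assume *: "f \<in> coord_ring Z" "g \<in> coord_ring Z" "k \<in> coord_ring Z" "z \<in> Z"
  from *(1-3) show "bracket f (bracket g k) z + bracket g (bracket k f) z + bracket k (bracket f g) z = 0"
  proof (elim coord_ring_cases)
    fix p q r assume pqr: "real_polynomial_function p" "f = restrict p Z"
      "real_polynomial_function q" "g = restrict q Z" "real_polynomial_function r" "k = restrict r Z"
    then show ?thesis
      using jacobiator_vanishes[of p q r z] *(4)
      by (simp add: bracket_restrict br_polynomial jacobiator_def)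
  qed
qed

end

section \<open>Pushing a Poisson bracket forward\<close>

text \<open>Since \<open>\<Gamma>\<close> is onto, a function on \<open>Y\<close> is determined by its pullback to \<open>Z\<close>. By the chain rule for
  brackets the pullbacks are closed under the bracket of \<open>Z\<close> once the components of \<open>\<Gamma>\<close> are; the
  bracket on \<open>Y\<close> is then the only possible one, and each Poisson axiom is the pulled-back axiom.\<close>

theorem induced_bracket_ex1:
  fixes \<Gamma> :: "'a::euclidean_space \<Rightarrow> 'b::euclidean_space"
  assumes B: "poisson_bracket Z B" and \<Gamma>: "polynomial_function \<Gamma>" and onto: "\<Gamma> ` Z = Y"
    and closed: "\<And>b c. b \<in> Basis \<Longrightarrow> c \<in> Basis \<Longrightarrow> \<exists>\<pi>. real_polynomial_function \<pi> \<and>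
      (\<forall>z\<in>Z. B (\<lambda>z\<in>Z. \<Gamma> z \<bullet> b) (\<lambda>z\<in>Z. \<Gamma> z \<bullet> c) z = \<pi> (\<Gamma> z))"
  shows "\<exists>!P. induced_bracket Z B \<Gamma> Y P"
proof -
  let ?R = "coord_ring Y"
  have pull: "compose Z f \<Gamma> \<in> coord_ring Z" if "f \<in> ?R" for f
    using that
  proof (elim coord_ring_cases)
    fix p assume p: "real_polynomial_function p" and f: "f = restrict p Y"
    have "compose Z f \<Gamma> = restrict (p \<circ> \<Gamma>) Z" using onto f by (auto simp: compose_def fun_eq_iff)
    then show ?thesis
      using restrict_in_coord_ring[OF real_polynomial_function_compose[OF \<Gamma> p]] by metis
  qed
  have inj: "f = g" if "f \<in> ?R" "g \<in> ?R" "\<And>z. z \<in> Z \<Longrightarrow> f (\<Gamma> z) = g (\<Gamma> z)" for f g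
    using that onto by (intro coord_ring_eqI[of f Y g]) auto
  from closed obtain \<pi> where \<pi>: "\<And>b c. b \<in> Basis \<Longrightarrow> c \<in> Basis \<Longrightarrow> real_polynomial_function (\<pi> b c)"
    "\<And>b c z. b \<in> Basis \<Longrightarrow> c \<in> Basis \<Longrightarrow> z \<in> Z \<Longrightarrow>
      B (\<lambda>z\<in>Z. \<Gamma> z \<bullet> b) (\<lambda>z\<in>Z. \<Gamma> z \<bullet> c) z = \<pi> b c (\<Gamma> z)"
    by metis
  have push: "\<exists>k\<in>?R. B (compose Z f \<Gamma>) (compose Z g \<Gamma>) = compose Z k \<Gamma>" if f: "f \<in> ?R" and g: "g \<in> ?R" for f g
  proof -
    obtain \<phi> \<psi> where \<phi>: "real_polynomial_function \<phi>" "f = restrict \<phi> Y"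
      and \<psi>: "real_polynomial_function \<psi>" "g = restrict \<psi> Y"
      using f g by (metis coord_ring_cases)
    define k where "k = (\<lambda>w\<in>Y. \<Sum>b\<in>Basis. \<Sum>c\<in>Basis. der \<phi> w b * der \<psi> w c * \<pi> b c w)"
    have k: "k \<in> ?R"
      unfolding k_def using \<pi>(1) \<phi> \<psi>
      by (intro restrict_in_coord_ring real_polynomial_function_sum finite_Basis
          real_polynomial_function.intros(4) polynomial_der)
    have c: "compose Z f \<Gamma> = (\<lambda>z\<in>Z. \<phi> (\<Gamma> z))" "compose Z g \<Gamma> = (\<lambda>z\<in>Z. \<psi> (\<Gamma> z))"
      using onto \<phi> \<psi> by (auto simp: compose_def fun_eq_iff)
    have "B (compose Z f \<Gamma>) (compose Z g \<Gamma>) = compose Z k \<Gamma>"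
    proof (rule coord_ring_eqI)
      fix z assume z: "z \<in> Z"
      then have "\<Gamma> z \<in> Y" using onto by auto
      then show "B (compose Z f \<Gamma>) (compose Z g \<Gamma>) z = compose Z k \<Gamma> z"
        unfolding c poisson_chain[OF B \<Gamma> \<phi>(1) \<psi>(1) z] using z \<pi>(2)
        by (simp add: compose_def k_def del: restrict_apply cong: sum.cong) simp
    qed (intro poisson_closed[OF B] pull f g k)+
    then show ?thesis using k by blast
  qed
  then obtain P0 where P0: "\<And>f g. f \<in> ?R \<Longrightarrow> g \<in> ?R \<Longrightarrow> P0 f g \<in> ?R"
    "\<And>f g. f \<in> ?R \<Longrightarrow> g \<in> ?R \<Longrightarrow> B (compose Z f \<Gamma>) (compose Z g \<Gamma>) = compose Z (P0 f g) \<Gamma>"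
    by metis
  define P where "P = (\<lambda>f\<in>?R. \<lambda>g\<in>?R. P0 f g)"
  have PE: "P \<in> ?R \<rightarrow>\<^sub>E ?R \<rightarrow>\<^sub>E ?R" unfolding P_def using P0(1) by auto
  have PR: "P f g \<in> ?R" if "f \<in> ?R" "g \<in> ?R" for f g using that P0(1) by (simp add: P_def)
  have PB: "B (compose Z f \<Gamma>) (compose Z g \<Gamma>) = compose Z (P f g) \<Gamma>" if "f \<in> ?R" "g \<in> ?R" for f g
    using that P0(2) by (simp add: P_def)
  have Peval: "P f g (\<Gamma> z) = B (compose Z f \<Gamma>) (compose Z g \<Gamma>) z" if "f \<in> ?R" "g \<in> ?R" "z \<in> Z" for f g z
    using PB[OF that(1,2)] that(3) by (simp add: compose_def)
  have lin: "(\<lambda>w\<in>Y. a * f w + b * g w) \<in> ?R" if "f \<in> ?R" "g \<in> ?R" for a b f g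
    using that
  proof (elim coord_ring_cases)
    fix p q assume *: "real_polynomial_function p" "f = restrict p Y" "real_polynomial_function q" "g = restrict q Y"
    then have "(\<lambda>w\<in>Y. a * f w + b * g w) = (\<lambda>w\<in>Y. a * p w + b * q w)" by auto
    then show ?thesis using * restrict_in_coord_ring polynomial_lincomb by metis
  qed
  have mul: "(\<lambda>w\<in>Y. f w * g w) \<in> ?R" if "f \<in> ?R" "g \<in> ?R" for f g
    using that
  proof (elim coord_ring_cases)
    fix p q assume *: "real_polynomial_function p" "f = restrict p Y" "real_polynomial_function q" "g = restrict q Y"
    then have "(\<lambda>w\<in>Y. f w * g w) = (\<lambda>w\<in>Y. p w * q w)" by auto
    then show ?thesis using * by (auto intro!: restrict_in_coord_ring)
  qed
  have comp: "compose Z (\<lambda>w\<in>Y. F w) \<Gamma> = (\<lambda>z\<in>Z. F (\<Gamma> z))" for F :: "'b \<Rightarrow> real"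
    using onto by (auto simp: compose_def fun_eq_iff)
  have ball: "(\<forall>w\<in>Y. Q w) \<longleftrightarrow> (\<forall>z\<in>Z. Q (\<Gamma> z))" for Q using onto by auto
  have compapp: "z \<in> Z \<Longrightarrow> compose Z f \<Gamma> z = f (\<Gamma> z)" for f :: "'b \<Rightarrow> real" and z by (simp add: compose_def)
  have "poisson_bracket Y P"
    unfolding poisson_bracket_def ball
  proof (intro conjI ballI allI)
    show "P \<in> ?R \<rightarrow>\<^sub>E ?R \<rightarrow>\<^sub>E ?R" by (rule PE)
  next
    fix f g z assume "f \<in> ?R" "g \<in> ?R" "z \<in> Z"
    then show "P f g (\<Gamma> z) = - P g f (\<Gamma> z)"
      using poisson_skew[OF B pull[of f] pull[of g], of z] by (simp add: Peval)
  next
    fix f g k a b z assume *: "f \<in> ?R" "g \<in> ?R" "k \<in> ?R" "z \<in> Z"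
    have "(\<lambda>z\<in>Z. a * f (\<Gamma> z) + b * g (\<Gamma> z)) = (\<lambda>z\<in>Z. a * compose Z f \<Gamma> z + b * compose Z g \<Gamma> z)"
      by (auto simp: compose_def)
    then show "P (\<lambda>w\<in>Y. a * f w + b * g w) k (\<Gamma> z) = a * P f k (\<Gamma> z) + b * P g k (\<Gamma> z)"
      using * poisson_linear[OF B pull[of f] pull[of g] pull[of k], of z] by (simp add: Peval lin comp del: restrict_apply)
  next
    fix f g k z assume *: "f \<in> ?R" "g \<in> ?R" "k \<in> ?R" "z \<in> Z"
    have "(\<lambda>z\<in>Z. f (\<Gamma> z) * g (\<Gamma> z)) = (\<lambda>z\<in>Z. compose Z f \<Gamma> z * compose Z g \<Gamma> z)"
      by (auto simp: compose_def)
    then show "P (\<lambda>w\<in>Y. f w * g w) k (\<Gamma> z) = f (\<Gamma> z) * P g k (\<Gamma> z) + g (\<Gamma> z) * P f k (\<Gamma> z)"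
      using * poisson_leibniz[OF B pull[of f] pull[of g] pull[of k], of z] by (simp add: Peval mul comp compapp del: restrict_apply)
  next
    fix f g k z assume *: "f \<in> ?R" "g \<in> ?R" "k \<in> ?R" "z \<in> Z"
    then show "P f (P g k) (\<Gamma> z) + P g (P k f) (\<Gamma> z) + P k (P f g) (\<Gamma> z) = 0"
      using poisson_jacobi[OF B pull[of f] pull[of g] pull[of k], of z] by (simp add: Peval PR PB[symmetric])
  qed
  then have ind: "induced_bracket Z B \<Gamma> Y P"
    unfolding induced_bracket_def using PB by blast
  moreover have "P' = P" if "induced_bracket Z B \<Gamma> Y P'" for P'
  proof (rule poisson_bracket_unique)
    show P': "poisson_bracket Y P'" and P: "poisson_bracket Y P"
      using that ind by (auto simp: induced_bracket_def)
    fix b c :: 'b and w assume "w \<in> Y"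
    then obtain z where z: "z \<in> Z" "w = \<Gamma> z" using onto by auto
    have r: "coord Y b \<in> ?R" for b
      unfolding coord_def by (intro restrict_in_coord_ring polynomial_coordinate)
    have "compose Z (P' (coord Y b) (coord Y c)) \<Gamma> z = compose Z (P (coord Y b) (coord Y c)) \<Gamma> z"
      using that ind r by (simp add: induced_bracket_def)
    then show "P' (coord Y b) (coord Y c) w = P (coord Y b) (coord Y c) w"
      using z by (simp add: compose_def)
  qed
  ultimately show ?thesis by blast
qed

section \<open>The Dirac-Poisson bracket\<close>

text \<open>Turns the Lorentz product into the Euclidean one, \<open>lorentz v w = lorentz_dual v \<bullet> w\<close>.\<close>

definition lorentz_dual :: "real^3 \<Rightarrow> real^3" where
  "lorentz_dual v = (\<chi> i. lorentz_metric i i * v$i)"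

lemma lorentz_dual_nth [simp]: "lorentz_dual v $ 1 = v$1" "lorentz_dual v $ 2 = v$2" "lorentz_dual v $ 3 = - v$3"
  by (simp_all add: lorentz_dual_def lorentz_metric_def)

lemma inner_lorentz_dual: "lorentz_dual v \<bullet> w = lorentz v w" "w \<bullet> lorentz_dual v = lorentz v w"
  by (simp_all add: inner_vec_def sum_3 lorentz_def mult.commute)

lemma lorentz_sym: "lorentz v w = lorentz w v"
  by (simp add: lorentz_def mult.commute)

lemma lorentz_simps:
  "lorentz (u + v) w = lorentz u w + lorentz v w" "lorentz w (u + v) = lorentz w u + lorentz w v"
  "lorentz (u - v) w = lorentz u w - lorentz v w" "lorentz w (u - v) = lorentz w u - lorentz w v"
  "lorentz (c *\<^sub>R u) w = c * lorentz u w" "lorentz w (c *\<^sub>R u) = c * lorentz w u"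
  "lorentz (- u) w = - lorentz u w" "lorentz w (- u) = - lorentz w u"
  "lorentz u (lorentz_dual v) = u \<bullet> v" "lorentz (lorentz_dual v) u = u \<bullet> v"
  by (simp_all add: lorentz_def inner_vec_def sum_3 algebra_simps)

text \<open>The first argument is a gradient \<open>(a, b)\<close> with respect to \<open>(x, y)\<close>. Contracting the three relations
  \<open>{x\<^sub>i, x\<^sub>j} = 0\<close>, \<open>{x\<^sub>i, y\<^sub>j} = g\<^sub>i\<^sub>j + x\<^sub>i x\<^sub>j\<close>, \<open>{y\<^sub>i, y\<^sub>j} = x\<^sub>i y\<^sub>j - x\<^sub>j y\<^sub>i\<close> with it
  gives this vector, so that no sums over coordinates occur in the computations.\<close>

definition dirac_field :: "R6 \<Rightarrow> R6 \<Rightarrow> R6" where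
  "dirac_field = (\<lambda>(a, b) (x, y). (- lorentz_dual b - (b \<bullet> x) *\<^sub>R x,
     lorentz_dual a + (a \<bullet> x) *\<^sub>R x + (b \<bullet> x) *\<^sub>R y - (b \<bullet> y) *\<^sub>R x))"

lemma dirac_field_inner:
  "dirac_field u z \<bullet> v =
     - lorentz (snd u) (fst v) - (fst z \<bullet> snd u) * (fst z \<bullet> fst v)
     + lorentz (fst u) (snd v) + (fst z \<bullet> fst u) * (fst z \<bullet> snd v)
     + (fst z \<bullet> snd u) * (snd z \<bullet> snd v) - (snd z \<bullet> snd u) * (fst z \<bullet> snd v)"
  by (cases u; cases z; cases v)
    (simp add: dirac_field_def inner_lorentz_dual inner_add_left inner_diff_left inner_commute algebra_simps)

lemma dirac_field_skew: "dirac_field u z \<bullet> v = - (dirac_field v z \<bullet> u)"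
  by (simp add: dirac_field_inner lorentz_sym algebra_simps)

lemma dirac_field_polynomial: "polynomial_function (dirac_field u)"
proof -
  have "real_polynomial_function (\<lambda>z::R6. fst z \<bullet> v)" "real_polynomial_function (\<lambda>z::R6. snd z \<bullet> v)" for v
    by (intro real_polynomial_function.intros(1) bounded_linear_compose[OF bounded_linear_inner_left]
        bounded_linear_fst bounded_linear_snd)+
  then show ?thesis
    unfolding polynomial_function_iff_Basis_inner dirac_field_inner
    by (intro ballI real_polynomial_function.intros(2,3,4) real_polynomial_function_diff)
qed

lemma der_dirac_field:
  "der (\<lambda>z. dirac_field u z \<bullet> v) z w =
     - (fst w \<bullet> snd u) * (fst z \<bullet> fst v) - (fst z \<bullet> snd u) * (fst w \<bullet> fst v)
     + (fst w \<bullet> fst u) * (fst z \<bullet> snd v) + (fst z \<bullet> fst u) * (fst w \<bullet> snd v)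
     + (fst w \<bullet> snd u) * (snd z \<bullet> snd v) + (fst z \<bullet> snd u) * (snd w \<bullet> snd v)
     - (snd w \<bullet> snd u) * (fst z \<bullet> snd v) - (snd z \<bullet> snd u) * (fst w \<bullet> snd v)"
  unfolding dirac_field_inner
  by (rule der_eqI) (auto intro!: derivative_eq_intros simp: algebra_simps)

text \<open>The identity holds in the whole ambient space, not only on \<open>VH\<close>: after expansion it is a polynomial
  identity in inner products, with the Lorentz products symmetric.\<close>

lemma dirac_field_jacobi:
  "der (\<lambda>z. dirac_field b z \<bullet> c) z (dirac_field a z)
   + der (\<lambda>z. dirac_field c z \<bullet> a) z (dirac_field b z)
   + der (\<lambda>z. dirac_field a z \<bullet> b) z (dirac_field c z) = 0"
proof -
  obtain a1 a2 b1 b2 c1 c2 x y where [simp]: "a = (a1, a2)" "b = (b1, b2)" "c = (c1, c2)" "z = (x, y)"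
    by (metis surj_pair)
  have [simp]: "lorentz b2 a1 = lorentz a1 b2" "lorentz b2 a2 = lorentz a2 b2"
    "lorentz c2 a1 = lorentz a1 c2" "lorentz c2 a2 = lorentz a2 c2" "lorentz c2 b1 = lorentz b1 c2"
    "lorentz c2 b2 = lorentz b2 c2" "lorentz c1 b2 = lorentz b2 c1" "lorentz b1 a2 = lorentz a2 b1"
    "lorentz c1 a2 = lorentz a2 c1"
    by (rule lorentz_sym)+
  show ?thesis
    unfolding der_dirac_field
    by (simp add: dirac_field_def inner_lorentz_dual inner_add_left inner_diff_left inner_commute[of _ x]
        inner_commute[of _ y] algebra_simps)
qed

text \<open>The two linear conditions say that \<open>(a, b)\<close> annihilates the differentials of the two equations of
  \<open>VH\<close>. A curve in \<open>VH\<close> with this velocity is obtained by rescaling \<open>x + t a\<close> to Lorentz square \<open>-1\<close>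
  and projecting \<open>y + t b\<close> along it; a polynomial vanishing on \<open>VH\<close> is constant along the curve.\<close>

lemma der_tangent_VH:
  assumes z: "(x, y) \<in> VH" and a: "lorentz x a = 0" and b: "lorentz a y + lorentz x b = 0"
    and p: "real_polynomial_function p" and zero: "\<And>z. z \<in> VH \<Longrightarrow> p z = 0"
  shows "der p (x, y) (a, b) = 0"
proof -
  \<comment> \<open>\<open>lorentz (x + t a) (x + t a) = - (1 - t\<^sup>2 lorentz a a)\<close> and
  \<open>lorentz (x + t a) (y + t b) = t\<^sup>2 lorentz a b\<close>; both corrections are of second order in \<open>t\<close>,
  so that the velocity at \<open>0\<close> is \<open>(a, b)\<close>.\<close>
  define s where "s t = 1 / sqrt (1 - t\<^sup>2 * lorentz a a)" for t :: real
  define \<gamma> where "\<gamma> t = (s t *\<^sub>R (x + t *\<^sub>R a),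
    y + t *\<^sub>R b + ((s t)\<^sup>2 * t\<^sup>2 * lorentz a b) *\<^sub>R (x + t *\<^sub>R a))" for t
  have s0: "s 0 = 1" by (simp add: s_def)
  have s': "(s has_real_derivative 0) (at 0)"
    unfolding s_def by (auto intro!: derivative_eq_intros)
  have \<gamma>0: "\<gamma> 0 = (x, y)" by (simp add: \<gamma>_def s0)
  have "((\<lambda>t. s t *\<^sub>R (x + t *\<^sub>R a)) has_vector_derivative a) (at 0)"
    by (auto intro!: derivative_eq_intros s' simp: s0)
  moreover have "((\<lambda>t. y + t *\<^sub>R b + ((s t)\<^sup>2 * t\<^sup>2 * lorentz a b) *\<^sub>R (x + t *\<^sub>R a))
      has_vector_derivative b) (at 0)"
    by (auto intro!: derivative_eq_intros s' simp: s0)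
  ultimately have \<gamma>': "(\<gamma> has_vector_derivative (a, b)) (at 0)"
    unfolding \<gamma>_def by (rule has_vector_derivative_Pair)
  have "((\<lambda>t. p (\<gamma> t)) has_vector_derivative der p (x, y) (a, b)) (at 0)"
    using has_derivative_compose[OF \<gamma>'[unfolded has_vector_derivative_def], of p "der p (x, y)"]
      \<gamma>0 has_derivative_der[OF p, of "(x, y)"] linear_cmul[OF der_linear[OF p]]
    by (simp add: has_vector_derivative_def del: scaleR_Pair)
  moreover have "\<forall>\<^sub>F t in at 0. p (\<gamma> t) = 0"
  proof -
    have "((\<lambda>t. 1 - t\<^sup>2 * lorentz a a) \<longlongrightarrow> 1) (at 0)"
      by (auto intro!: tendsto_eq_intros)
    then have "\<forall>\<^sub>F t in at 0. 1 - t\<^sup>2 * lorentz a a > 0"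
      by (rule order_tendstoD) simp
    then show ?thesis
    proof (rule eventually_mono)
      fix t assume t: "1 - t\<^sup>2 * lorentz a a > 0"
      then have s2: "(s t)\<^sup>2 * (1 - t\<^sup>2 * lorentz a a) = 1"
        by (simp add: s_def power_divide)
      have xx: "lorentz x x = -1" and xy: "lorentz x y = 0" using z by (auto simp: VH_def)
      have ax: "lorentz a x = 0" using a lorentz_sym by metis
      define u where "u = x + t *\<^sub>R a"
      have uu: "lorentz u u = - (1 - t\<^sup>2 * lorentz a a)"
        using a ax xx by (simp add: u_def lorentz_simps power2_eq_square)
      have "lorentz u (y + t *\<^sub>R b) = t * (lorentz a y + lorentz x b) + t\<^sup>2 * lorentz a b"
        using xy by (simp add: u_def lorentz_simps power2_eq_square algebra_simps)
      then have uv: "lorentz u (y + t *\<^sub>R b) = t\<^sup>2 * lorentz a b" using b by simp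
      have "lorentz (s t *\<^sub>R u) (s t *\<^sub>R u) = - ((s t)\<^sup>2 * (1 - t\<^sup>2 * lorentz a a))"
        by (simp add: lorentz_simps uu power2_eq_square algebra_simps)
      then have 1: "lorentz (s t *\<^sub>R u) (s t *\<^sub>R u) = -1" using s2 by simp
      have "lorentz (s t *\<^sub>R u) (v + ((s t)\<^sup>2 * t\<^sup>2 * lorentz a b) *\<^sub>R u)
          = s t * t\<^sup>2 * lorentz a b * (1 - (s t)\<^sup>2 * (1 - t\<^sup>2 * lorentz a a))"
        if "lorentz u v = t\<^sup>2 * lorentz a b" for v
        by (simp add: lorentz_simps(2,5,6) uu that algebra_simps)
      from this[OF uv]
      have "\<gamma> t \<in> VH" using s2 1 by (simp add: \<gamma>_def VH_def u_def[symmetric])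
      then show "p (\<gamma> t) = 0" by (rule zero)
    qed
  qed
  ultimately have "((\<lambda>t. 0::real) has_vector_derivative der p (x, y) (a, b)) (at 0)"
    unfolding has_vector_derivative_def
    by (rule has_derivative_transform_eventually) (use zero z \<gamma>0 in auto)
  then show ?thesis
    using vector_derivative_unique_at has_vector_derivative_const by metis
qed

text \<open>The two equations of \<open>VH\<close> are Casimirs on \<open>VH\<close>: their derivatives along \<open>dirac_field u z\<close> are
  multiples of \<open>lorentz x x + 1\<close>, so the fields are tangent.\<close>

interpretation VH: hamiltonian_fields VH dirac_field
proof
  show "polynomial_function (dirac_field b)" for b by (rule dirac_field_polynomial)
  show "dirac_field b z \<bullet> c = - (dirac_field c z \<bullet> b)" for b c z by (rule dirac_field_skew)
  show "der (\<lambda>z. dirac_field b z \<bullet> c) z (dirac_field a z)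
   + der (\<lambda>z. dirac_field c z \<bullet> a) z (dirac_field b z)
   + der (\<lambda>z. dirac_field a z \<bullet> b) z (dirac_field c z) = 0" for a b c z
    by (rule dirac_field_jacobi)
  fix p :: "R6 \<Rightarrow> real" and u z :: R6
  assume p: "real_polynomial_function p" "\<And>z. z \<in> VH \<Longrightarrow> p z = 0" and z: "z \<in> VH"
  obtain x y a b where [simp]: "z = (x, y)" "u = (a, b)" by (metis surj_pair)
  have xx: "lorentz x x = -1" and xy: "lorentz x y = 0" "lorentz y x = 0"
    using z by (auto simp: VH_def lorentz_sym)
  show "der p z (dirac_field u z) = 0"
    unfolding \<open>z = _\<close> \<open>u = _\<close> dirac_field_def prod.case
    by (rule der_tangent_VH[OF _ _ _ p])
      (use z xx xy in \<open>simp_all add: lorentz_simps inner_commute algebra_simps\<close>)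
qed

lemma Basis_vec_real: "(Basis :: (real^'n) set) = range (\<lambda>i. axis i 1)"
  by (auto simp: Basis_vec_def)

lemma dirac_bracket_eq: "dirac_bracket = VH.bracket"
  unfolding dirac_bracket_def
proof (rule the_equality, intro conjI)
  show PB: "poisson_bracket VH VH.bracket" by (rule VH.poisson_bracket_bracket)
  have inB: "(axis i 1, 0) \<in> (Basis :: R6 set)" "(0, axis i 1) \<in> (Basis :: R6 set)" for i
    by (auto simp: Basis_prod_def)
  have [simp]: "lorentz (axis i 1) (axis j 1) = lorentz_metric i j" for i j
    by (simp add: inner_lorentz_dual(1)[symmetric] inner_axis lorentz_dual_def) (simp add: axis_def lorentz_metric_def)
  have [simp]: "lorentz 0 v = 0" "lorentz v 0 = 0" for v by (simp_all add: lorentz_def)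
  show rel: "\<forall>(x, y)\<in>VH. \<forall>i j. VH.bracket (xcoord i) (xcoord j) (x, y) = 0 \<and>
        VH.bracket (xcoord i) (ycoord j) (x, y) = lorentz_metric i j + x $ i * x $ j \<and>
        VH.bracket (ycoord i) (ycoord j) (x, y) = x $ i * y $ j - x $ j * y $ i"
    by (auto simp: VH.bracket_coord inB dirac_field_inner cart_eq_inner_axis[symmetric])
  fix D assume *: "poisson_bracket VH D \<and>
     (\<forall>(x, y)\<in>VH. \<forall>i j.
        D (xcoord i) (xcoord j) (x, y) = 0 \<and>
        D (xcoord i) (ycoord j) (x, y) = lorentz_metric i j + x$i * x$j \<and>
        D (ycoord i) (ycoord j) (x, y) = x$i * y$j - x$j * y$i)"
  have cr: "coord VH b \<in> coord_ring VH" for b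
    unfolding coord_def by (intro restrict_in_coord_ring polynomial_coordinate)
  show "D = VH.bracket"
  proof (rule poisson_bracket_unique[OF _ PB])
    show D: "poisson_bracket VH D" using * by blast
    fix b c z assume b: "b \<in> (Basis :: R6 set)" and c: "c \<in> (Basis :: R6 set)" and z: "z \<in> VH"
    obtain x y where xy: "z = (x, y)" by (cases z)
    have cases: "(\<exists>i. b = (axis i 1, 0)) \<or> (\<exists>i. b = (0, axis i 1))" if "b \<in> (Basis :: R6 set)" for b
      using that by (auto simp: Basis_prod_def Basis_vec_real)
    have D': "D (xcoord i) (xcoord j) z = 0" "D (xcoord i) (ycoord j) z = lorentz_metric i j + x$i * x$j"
      "D (ycoord i) (ycoord j) z = x$i * y$j - x$j * y$i" for i j
      using * z xy by auto
    have B': "VH.bracket (xcoord i) (xcoord j) z = 0"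
      "VH.bracket (xcoord i) (ycoord j) z = lorentz_metric i j + x$i * x$j"
      "VH.bracket (ycoord i) (ycoord j) z = x$i * y$j - x$j * y$i" for i j
      using rel z xy by auto
    have "D (ycoord i) (xcoord j) z = VH.bracket (ycoord i) (xcoord j) z" for i j
      using poisson_skew[OF D cr cr z] poisson_skew[OF PB cr cr z] D'(2) B'(2) by metis
    then show "D (coord VH b) (coord VH c) z = VH.bracket (coord VH b) (coord VH c) z"
      using cases[OF b] cases[OF c] D' B' by auto
  qed
qed

lemma dirac_bracket_poisson: "poisson_bracket VH dirac_bracket"
  by (simp add: dirac_bracket_eq VH.poisson_bracket_bracket)

text \<open>By skewness and bilinearity of \<open>dirac_field\<close>, the bracket is evaluated from gradients without
  reference to a basis.\<close>

lemma dirac_bracket_gradients: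
  assumes p: "real_polynomial_function p" and q: "real_polynomial_function q"
    and gp: "(p has_derivative (\<lambda>v. v \<bullet> u)) (at z)" and gq: "(q has_derivative (\<lambda>v. v \<bullet> v')) (at z)"
    and z: "z \<in> VH"
  shows "dirac_bracket (restrict p VH) (restrict q VH) z = dirac_field u z \<bullet> v'"
proof -
  have "dirac_bracket (restrict p VH) (restrict q VH) z =
      (\<Sum>b\<in>Basis. (b \<bullet> u) * (dirac_field b z \<bullet> v'))"
    using z by (simp add: dirac_bracket_eq VH.bracket_restrict p q hamiltonian_bracket_def
        der_eqI[OF gp] der_eqI[OF gq])
  also have "\<dots> = - (\<Sum>b\<in>Basis. (dirac_field v' z \<bullet> b) * (u \<bullet> b))"
    by (subst dirac_field_skew) (simp add: sum_negf inner_commute mult.commute)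
  also have "\<dots> = dirac_field u z \<bullet> v'"
    by (simp add: euclidean_inner[symmetric] dirac_field_skew[of u z v'])
  finally show ?thesis .
qed

lemma hamiltonian_field_dirac:
  assumes "(h has_derivative (\<lambda>v. v \<bullet> u)) (at z)" and z: "z \<in> VH"
  shows "hamiltonian_field VH dirac_bracket h z = - dirac_field u z"
proof (rule euclidean_eqI)
  fix b :: R6 assume b: "b \<in> Basis"
  have "hamiltonian_field VH dirac_bracket h z \<bullet> b = smooth_bracket VH dirac_bracket (coord VH b) h z"
    using b by (simp add: hamiltonian_field_def)
  also have "\<dots> = (\<Sum>c\<in>Basis. (dirac_field b z \<bullet> c) * (u \<bullet> c))"
    using b z by (simp add: smooth_bracket_def dirac_bracket_eq VH.bracket_coord der_eqI[OF assms(1)] inner_commute)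
  also have "\<dots> = - dirac_field u z \<bullet> b"
    by (simp add: euclidean_inner[symmetric] dirac_field_skew[of b z u])
  finally show "hamiltonian_field VH dirac_bracket h z \<bullet> b = - dirac_field u z \<bullet> b" .
qed

section \<open>Orbits of the hyperbolic rotations\<close>

text \<open>In coordinates along orthogonal asymptotes a hyperbola is \<open>a b = 1\<close>; rotating the normalised
  asymptotic directions by 45 degrees gives the principal axes \<open>e\<^sub>1\<close>, \<open>e\<^sub>2\<close>. The semi-axes are both
  \<open>sqrt (2 |u| |v|)\<close>.\<close>

lemma hyperbola_asymptotes:
  fixes c u v :: "'a::euclidean_space"
  assumes uv: "u \<bullet> v = 0" and u: "u \<noteq> 0" and v: "v \<noteq> 0"
  shows "hyperbola {c + a *\<^sub>R u + b *\<^sub>R v |a b. a * b = 1}" (is "hyperbola ?C")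
proof -
  define \<mu> \<nu> where "\<mu> = norm u" and "\<nu> = norm v"
  have pos: "\<mu> > 0" "\<nu> > 0" using u v by (auto simp: \<mu>_def \<nu>_def)
  have uu: "u \<bullet> u = \<mu>\<^sup>2" and vv: "v \<bullet> v = \<nu>\<^sup>2" and vu: "v \<bullet> u = 0"
    using uv by (auto simp: \<mu>_def \<nu>_def power2_norm_eq_inner inner_commute)
  define r where "r = sqrt 2"
  have r: "r > 0" "r * r = 2" by (auto simp: r_def)
  define e\<^sub>1 e\<^sub>2 where "e\<^sub>1 = (1 / (r * \<mu>)) *\<^sub>R u + (1 / (r * \<nu>)) *\<^sub>R v"
    and "e\<^sub>2 = (1 / (r * \<mu>)) *\<^sub>R u - (1 / (r * \<nu>)) *\<^sub>R v"
  define \<alpha> where "\<alpha> = sqrt (2 * \<mu> * \<nu>)"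
  have \<alpha>: "\<alpha> > 0" "\<alpha>\<^sup>2 = 2 * \<mu> * \<nu>" using pos by (auto simp: \<alpha>_def)
  have "e\<^sub>1 \<bullet> e\<^sub>1 = 1" "e\<^sub>2 \<bullet> e\<^sub>2 = 1" "e\<^sub>1 \<bullet> e\<^sub>2 = 0"
    using pos r unfolding e\<^sub>1_def e\<^sub>2_def
    by (simp_all add: inner_add_left inner_add_right inner_diff_left inner_diff_right uu vv uv vu
        power2_eq_square field_simps)
  then have e: "norm e\<^sub>1 = 1" "norm e\<^sub>2 = 1" "e\<^sub>1 \<bullet> e\<^sub>2 = 0"
    by (simp_all add: norm_eq_sqrt_inner)
  have to_asym: "c + m *\<^sub>R e\<^sub>1 + n *\<^sub>R e\<^sub>2 =
      c + ((m + n) / (r * \<mu>)) *\<^sub>R u + ((m - n) / (r * \<nu>)) *\<^sub>R v" for m n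
    by (simp add: e\<^sub>1_def e\<^sub>2_def add_divide_distrib diff_divide_distrib algebra_simps)
  have eq: "m\<^sup>2 / \<alpha>\<^sup>2 - n\<^sup>2 / \<alpha>\<^sup>2 = ((m + n) / (r * \<mu>)) * ((m - n) / (r * \<nu>))" for m n
  proof -
    have "((m + n) / (r * \<mu>)) * ((m - n) / (r * \<nu>)) = ((m + n) * (m - n)) / ((r * r) * \<mu> * \<nu>)"
      by (simp add: mult_ac)
    then show ?thesis using r(2) \<alpha>(2)
      by (simp add: diff_divide_distrib[symmetric] power2_eq_square algebra_simps)
  qed
  have "?C = {c + m *\<^sub>R e\<^sub>1 + n *\<^sub>R e\<^sub>2 |m n. m\<^sup>2 / \<alpha>\<^sup>2 - n\<^sup>2 / \<alpha>\<^sup>2 = 1}"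
  proof (intro equalityI subsetI)
    fix w assume "w \<in> ?C"
    then obtain a b where ab: "a * b = 1" "w = c + a *\<^sub>R u + b *\<^sub>R v" by blast
    define m n where "m = r * (a * \<mu> + b * \<nu>) / 2" and "n = r * (a * \<mu> - b * \<nu>) / 2"
    have "(m + n) / (r * \<mu>) = a" "(m - n) / (r * \<nu>) = b"
      using r(1) pos by (auto simp: m_def n_def field_simps)
    then show "w \<in> {c + m *\<^sub>R e\<^sub>1 + n *\<^sub>R e\<^sub>2 |m n. m\<^sup>2 / \<alpha>\<^sup>2 - n\<^sup>2 / \<alpha>\<^sup>2 = 1}"
      using ab to_asym[of m n] eq[of m n] by (intro CollectI exI[of _ m] exI[of _ n]) simp
  next
    fix w assume "w \<in> {c + m *\<^sub>R e\<^sub>1 + n *\<^sub>R e\<^sub>2 |m n. m\<^sup>2 / \<alpha>\<^sup>2 - n\<^sup>2 / \<alpha>\<^sup>2 = 1}"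
    then show "w \<in> ?C" unfolding to_asym eq by blast
  qed
  then show ?thesis
    unfolding hyperbola_def using e \<alpha>(1) by blast
qed

text \<open>The range is the part \<open>a > 0\<close> of the curve. A connected subset cannot contain points with \<open>a > 0\<close>
  and with \<open>a < 0\<close>, since the coordinate along \<open>u\<close> is continuous and never zero on the curve.\<close>

lemma hyperbola_branch_component:
  fixes c u v :: "'a::euclidean_space"
  assumes uv: "u \<bullet> v = 0" and u: "u \<noteq> 0"
  shows "range (\<lambda>s. c + exp s *\<^sub>R u + exp (- s) *\<^sub>R v)
    \<in> components {c + a *\<^sub>R u + b *\<^sub>R v |a b. a * b = 1}" (is "?O \<in> components ?C")
  unfolding in_components_maximal
proof (intro conjI allI impI)
  show "?O \<noteq> {}" by simp
  show "?O \<subseteq> ?C" using exp_add[of _ "- _"] by (fastforce simp: exp_minus_inverse)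
  show "connected ?O"
    by (intro connected_continuous_image continuous_intros) simp
  fix d assume d: "d \<noteq> {} \<and> ?O \<subseteq> d \<and> d \<subseteq> ?C \<and> connected d"
  have "w \<in> ?O" if w: "w \<in> d" for w
  proof -
    define f where "f w = (w - c) \<bullet> u" for w
    have f: "f (c + a *\<^sub>R u + b *\<^sub>R v) = a * (u \<bullet> u)" for a b
      using uv by (simp add: f_def inner_add_left inner_commute[of v u])
    have uu: "u \<bullet> u > 0" using u by simp
    obtain a b where ab: "a * b = 1" "w = c + a *\<^sub>R u + b *\<^sub>R v" using w d by blast
    have conn: "connected (f ` d)"
      unfolding f_def using d by (intro connected_continuous_image continuous_intros) auto
    have "c + exp 0 *\<^sub>R u + exp (- 0) *\<^sub>R v \<in> d" using d by blast
    then have "u \<bullet> u \<in> f ` d" using f[of 1 1] by (force simp: image_iff)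
    moreover have "a * (u \<bullet> u) \<in> f ` d" using w f ab by (metis image_eqI)
    moreover have "0 \<notin> f ` d"
    proof
      assume "0 \<in> f ` d"
      then obtain w' where w': "w' \<in> ?C" "f w' = 0"
        using d by (metis (no_types, lifting) imageE subsetD)
      then obtain a' b' where "a' * b' = 1" "w' = c + a' *\<^sub>R u + b' *\<^sub>R v" by blast
      then show False using uu f w' by auto
    qed
    ultimately have "\<not> a * (u \<bullet> u) \<le> 0"
      using connectedD_interval[OF conn, of "a * (u \<bullet> u)" "u \<bullet> u" 0] uu by auto
    then have a: "a > 0" using uu by (simp add: not_le zero_less_mult_iff)
    then have "w = c + exp (ln a) *\<^sub>R u + exp (- ln a) *\<^sub>R v"
      using ab by (simp add: exp_minus field_simps)
    then show ?thesis by (rule range_eqI)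
  qed
  then show "d = ?O" using d by (intro equalityI subsetI) auto
qed

lemma aff_dim_plane:
  fixes c u v :: "'a::euclidean_space"
  assumes "u \<bullet> v = 0" "u \<noteq> 0" "v \<noteq> 0"
  shows "affine ((+) c ` span {u, v})" "aff_dim ((+) c ` span {u, v}) = 2"
proof -
  show "affine ((+) c ` span {u, v})"
    by (simp add: subspace_imp_affine affine_translation[symmetric])
  have "u \<noteq> v" using assms by auto
  moreover have "independent {u, v}"
    using assms by (intro pairwise_orthogonal_independent)
      (auto simp: pairwise_def orthogonal_def inner_commute)
  ultimately have "dim (span {u, v}) = 2"
    by (simp add: dim_eq_card_independent)
  then show "aff_dim ((+) c ` span {u, v}) = 2"
    by (simp add: aff_dim_translation_eq aff_dim_subspace)
qed

lemma vec3_eqI: "x $ 1 = y $ 1 \<Longrightarrow> x $ 2 = y $ 2 \<Longrightarrow> x $ 3 = y $ 3 \<Longrightarrow> x = (y :: 'a^3)"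
  by (simp add: vec_eq_iff forall_3)

lemma TH2_x3_dominates:
  assumes "(x, y) \<in> TH2"
  shows "\<bar>x $ 2\<bar> < x $ 3"
proof -
  have x3: "x $ 3 > 0" and "(x $ 3)\<^sup>2 = (x $ 1)\<^sup>2 + (x $ 2)\<^sup>2 + 1"
    using assms by (auto simp: TH2_def VH_def lorentz_def power2_eq_square)
  then have "\<bar>x $ 2\<bar>\<^sup>2 < (x $ 3)\<^sup>2" by (simp add: add_nonneg_pos)
  then show ?thesis using x3 by (metis less_imp_le power2_less_imp_less)
qed

text \<open>\<open>(0, 1, 1)\<close> and \<open>(0, 1, -1)\<close> are eigenvectors of \<open>hyp_rot s\<close> for the eigenvalues \<open>exp s\<close> and
  \<open>exp (- s)\<close>, and the first coordinate is fixed.\<close>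

lemma orbit_h_exponential:
  "orbit_h (x, y) = range (\<lambda>s.
     (vector [x$1, 0, 0], vector [y$1, 0, 0])
     + exp s *\<^sub>R (((x$2 + x$3) / 2) *\<^sub>R vector [0, 1, 1], ((y$2 + y$3) / 2) *\<^sub>R vector [0, 1, 1])
     + exp (- s) *\<^sub>R (((x$2 - x$3) / 2) *\<^sub>R vector [0, 1, -1], ((y$2 - y$3) / 2) *\<^sub>R vector [0, 1, -1]))"
proof -
  have "hyp_rot s *v w = vector [w$1, 0, 0] + exp s *\<^sub>R (((w$2 + w$3) / 2) *\<^sub>R vector [0, 1, 1])
      + exp (- s) *\<^sub>R (((w$2 - w$3) / 2) *\<^sub>R vector [0, 1, -1])" for s w
    by (rule vec3_eqI) (simp_all add: hyp_rot_def matrix_vector_mult_def sum_3 cosh_def sinh_def field_simps)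
  then show ?thesis
    unfolding orbit_h_def G_h_def image_image diag_act_def by simp
qed

lemma orbit_h_hyperbola_branch:
  assumes z: "z \<in> TH2"
  shows "\<exists>A C. affine A \<and> aff_dim A = 2 \<and> C \<subseteq> A \<and> hyperbola C \<and> orbit_h z \<in> components C"
proof -
  obtain x y where xy: "z = (x, y)" by (cases z)
  define c u v :: R6 where "c = (vector [x$1, 0, 0], vector [y$1, 0, 0])"
    and "u = (((x$2 + x$3) / 2) *\<^sub>R vector [0, 1, 1], ((y$2 + y$3) / 2) *\<^sub>R vector [0, 1, 1])"
    and "v = (((x$2 - x$3) / 2) *\<^sub>R vector [0, 1, -1], ((y$2 - y$3) / 2) *\<^sub>R vector [0, 1, -1])"
  have orb: "orbit_h z = range (\<lambda>s. c + exp s *\<^sub>R u + exp (- s) *\<^sub>R v)"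
    unfolding xy c_def u_def v_def by (rule orbit_h_exponential)
  have uv: "u \<bullet> v = 0" by (simp add: u_def v_def inner_vec_def sum_3 field_simps)
  have "x$2 + x$3 \<noteq> 0" "x$2 - x$3 \<noteq> 0" using TH2_x3_dominates z xy by fastforce+
  then have nz: "u \<noteq> 0" "v \<noteq> 0"
    by (auto simp: u_def v_def zero_prod_def vec_eq_iff forall_3)
  let ?C = "{c + a *\<^sub>R u + b *\<^sub>R v |a b. a * b = 1}"
  have "a *\<^sub>R u + b *\<^sub>R v \<in> span {u, v}" for a b
    by (intro span_add span_scale span_base) auto
  then have "?C \<subseteq> (+) c ` span {u, v}" by (force simp: add.assoc)
  then show ?thesis
    unfolding orb using aff_dim_plane[OF uv nz] hyperbola_asymptotes[OF uv nz]
      hyperbola_branch_component[OF uv nz(1)]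
    by (intro exI[of _ "(+) c ` span {u, v}"] exI[of _ ?C] conjI)
qed

section \<open>The image of the invariant map\<close>

lemma vector_4 [simp]:
  "(vector [a, b, c, d] :: 'a::zero^4) $ 1 = a" "(vector [a, b, c, d] :: 'a^4) $ 2 = b"
  "(vector [a, b, c, d] :: 'a^4) $ 3 = c" "(vector [a, b, c, d] :: 'a^4) $ 4 = d"
  by (simp_all add: vector_def)

lemma Gam_nth [simp]:
  "Gam z $ 1 = fst z $ 1" "Gam z $ 2 = snd z $ 1" "Gam z $ 3 = lorentz (snd z) (snd z)"
  "Gam z $ 4 = fst z $ 3 * snd z $ 2 - fst z $ 2 * snd z $ 3"
  by (simp_all add: Gam_def tau1_def tau2_def tau3_def tau6_def lorentz_def power2_eq_square split: prod.split)

lemma Gam_VH_subset: "Gam ` VH \<subseteq> YH"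
proof clarify
  fix x y assume "(x, y) \<in> VH"
  then have "x$1 * x$1 + x$2 * x$2 - x$3 * x$3 + 1 = 0" "x$1 * y$1 + x$2 * y$2 - x$3 * y$3 = 0"
    by (auto simp: VH_def lorentz_def)
  then have "(x$3 * y$2 - x$2 * y$3)\<^sup>2 =
      ((x$1)\<^sup>2 + 1) * (y$1 * y$1 + y$2 * y$2 - y$3 * y$3) - (y$1)\<^sup>2"
    by algebra
  then show "Gam (x, y) \<in> YH" by (simp add: YH_def lorentz_def)
qed

text \<open>Every fibre meets \<open>x\<^sub>2 = 0\<close>, because an orbit in \<open>TH2\<close> can be rotated there. On this slice
  \<open>x\<^sub>3\<close>, \<open>y\<^sub>3\<close>, \<open>y\<^sub>2\<close> are forced, in this order, by \<open>lorentz x x = -1\<close>, \<open>lorentz x y = 0\<close> and the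
  value of \<open>\<tau>\<^sub>6\<close>; the equation of \<open>YH\<close> then gives the value of \<open>\<tau>\<^sub>3\<close>.\<close>

lemma YH_subset_Gam_TH2: "YH \<subseteq> Gam ` TH2"
proof
  fix w assume w: "w \<in> YH"
  define r where "r = sqrt (1 + (w$1)\<^sup>2)"
  have r: "r > 0" "r\<^sup>2 = 1 + (w$1)\<^sup>2" by (auto simp: r_def add_pos_nonneg)
  define x y :: "real^3" where "x = vector [w$1, 0, r]"
    and "y = vector [w$2, w$4 / r, w$1 * w$2 / r]"
  have "(x, y) \<in> TH2"
    using r by (simp add: TH2_def VH_def lorentz_def x_def y_def power2_eq_square)
  moreover have "Gam (x, y) = w"
  proof -
    have "w$2 * w$2 + (w$4 / r) * (w$4 / r) - (w$1 * w$2 / r) * (w$1 * w$2 / r)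
        = (w$2 * w$2 * r\<^sup>2 + (w$4)\<^sup>2 - (w$1)\<^sup>2 * (w$2)\<^sup>2) / r\<^sup>2"
      using r(1) by (simp add: field_simps power2_eq_square)
    also have "w$2 * w$2 * r\<^sup>2 + (w$4)\<^sup>2 - (w$1)\<^sup>2 * (w$2)\<^sup>2 = w$3 * r\<^sup>2"
      using w r(2) unfolding YH_def by (simp add: power2_eq_square algebra_simps)
    finally have "lorentz y y = w$3" using r(1) by (simp add: lorentz_def y_def)
    then show ?thesis
      using r(1) by (simp add: vec_eq_iff forall_4) (simp add: x_def y_def)
  qed
  ultimately show "w \<in> Gam ` TH2" by (metis image_eqI)
qed

lemma Gam_image: "Gam ` TH2 = YH" "Gam ` VH = YH"
  using Gam_VH_subset YH_subset_Gam_TH2 by (auto simp: TH2_def)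

section \<open>The reduced bracket\<close>

definition Gam_grad :: "R6 \<Rightarrow> R6^4" where
  "Gam_grad = (\<lambda>(x, y). vector
     [(axis 1 1, 0), (0, axis 1 1), (0, 2 *\<^sub>R lorentz_dual y), (vector [0, - y$3, y$2], vector [0, x$3, - x$2])])"

text \<open>The matrix of all brackets \<open>{w\<^sub>i, w\<^sub>j}\<close>, skew-symmetrically completed from the six relations.\<close>

definition reduced_tensor :: "real^4 \<Rightarrow> real^4^4" where
  "reduced_tensor w = vector
     [vector [0, 1 + (w$1)\<^sup>2, 2 * w$2, 0],
      vector [- (1 + (w$1)\<^sup>2), 0, 2 * w$1 * w$3, 0],
      vector [- 2 * w$2, - (2 * w$1 * w$3), 0, 0],
      vector [0, 0, 0, 0]]"

lemma Gam_has_gradient: "((\<lambda>z. Gam z $ i) has_derivative (\<lambda>v. v \<bullet> Gam_grad z $ i)) (at z)"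
proof -
  have 1: "((\<lambda>z::R6. fst z $ j) has_derivative (\<lambda>v. fst v $ j)) (at z)"
    "((\<lambda>z::R6. snd z $ j) has_derivative (\<lambda>v. snd v $ j)) (at z)" for j z
    by (intro bounded_linear_imp_has_derivative bounded_linear_compose[OF bounded_linear_vec_nth]
        bounded_linear_fst bounded_linear_snd)+
  have "\<forall>i. ((\<lambda>z. Gam z $ i) has_derivative (\<lambda>v. v \<bullet> Gam_grad z $ i)) (at z)"
    unfolding forall_4 Gam_nth Gam_grad_def lorentz_def
    by (cases z) (auto intro!: derivative_eq_intros 1 has_derivative_eq_rhs[OF 1(1)[of 1]]
        has_derivative_eq_rhs[OF 1(2)[of 1]] simp: inner_prod_def inner_axis inner_lorentz_dual lorentz_def inner_vec_def[of _ "vector _"] sum_3 algebra_simps)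
  then show ?thesis ..
qed

lemma Gam_nth_polynomial: "real_polynomial_function (\<lambda>z. Gam z $ i)"
proof -
  have 1: "real_polynomial_function (\<lambda>z::R6. fst z $ j)" "real_polynomial_function (\<lambda>z::R6. snd z $ j)" for j
    by (intro real_polynomial_function.intros(1) bounded_linear_compose[OF bounded_linear_vec_nth]
        bounded_linear_fst bounded_linear_snd)+
  have "\<forall>i. real_polynomial_function (\<lambda>z. Gam z $ i)"
    unfolding forall_4 Gam_nth lorentz_def
    by (intro conjI 1 real_polynomial_function_diff real_polynomial_function.intros(3,4))
  then show ?thesis ..
qed

lemma Gam_polynomial: "polynomial_function Gam"
  unfolding polynomial_function_iff_Basis_inner
  using Gam_nth_polynomial by (auto simp: Basis_vec_real inner_axis)

text \<open>By skew-symmetry only the six brackets above the diagonal need computation, and these take the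
  stated form modulo the two equations of \<open>VH\<close>.\<close>

lemma dirac_field_Gam_grad:
  assumes z: "z \<in> VH"
  shows "dirac_field (Gam_grad z $ i) z \<bullet> Gam_grad z $ j = reduced_tensor (Gam z) $ i $ j"
proof -
  obtain x y where xy: "z = (x, y)" by (cases z)
  let ?b = "\<lambda>i j. dirac_field (Gam_grad z $ i) z \<bullet> Gam_grad z $ j"
  have V: "x$1 * x$1 + x$2 * x$2 - x$3 * x$3 + 1 = 0" "x$1 * y$1 + x$2 * y$2 - x$3 * y$3 = 0"
    using z xy by (auto simp: VH_def lorentz_def)
  note expand = xy Gam_grad_def dirac_field_inner reduced_tensor_def lorentz_def inner_vec_def
    sum_3 axis_def power2_eq_square
  have self: "?b i i = 0" for i
    using dirac_field_skew[of "Gam_grad z $ i" z "Gam_grad z $ i"] by simp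
  have skew: "?b 2 1 = - ?b 1 2" "?b 3 1 = - ?b 1 3" "?b 3 2 = - ?b 2 3"
    "?b 4 1 = - ?b 1 4" "?b 4 2 = - ?b 2 4" "?b 4 3 = - ?b 3 4"
    by (rule dirac_field_skew)+
  have "?b 1 2 = 1 + (x$1)\<^sup>2" by (simp add: expand)
  moreover have "?b 1 3 = 2 * y$1" using V by (simp add: expand; algebra)
  moreover have "?b 2 3 = 2 * x$1 * lorentz y y" using V by (simp add: expand; algebra)
  moreover have "?b 1 4 = 0" using V by (simp add: expand)
  moreover have "?b 2 4 = 0" using V by (simp add: expand; algebra)
  moreover have "?b 3 4 = 0" using V by (simp add: expand; algebra)
  ultimately have "\<forall>i j. ?b i j = reduced_tensor (Gam z) $ i $ j"
    unfolding forall_4 self skew by (simp add: reduced_tensor_def xy)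
  then show ?thesis by blast
qed

lemma dirac_bracket_Gam:
  assumes z: "z \<in> VH"
  shows "dirac_bracket (\<lambda>z\<in>VH. Gam z $ i) (\<lambda>z\<in>VH. Gam z $ j) z = reduced_tensor (Gam z) $ i $ j"
  using dirac_bracket_gradients[OF Gam_nth_polynomial Gam_nth_polynomial Gam_has_gradient
      Gam_has_gradient z] dirac_field_Gam_grad[OF z] by simp

lemma reduced_tensor_polynomial: "real_polynomial_function (\<lambda>w. reduced_tensor w $ i $ j)"
proof -
  have 1: "real_polynomial_function (\<lambda>w::real^4. w $ j)" for j
    by (intro real_polynomial_function.intros(1) bounded_linear_vec_nth)
  have "\<forall>i j. real_polynomial_function (\<lambda>w. reduced_tensor w $ i $ j)"
    unfolding forall_4 reduced_tensor_def vector_4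
    by (intro conjI 1 real_polynomial_function.intros(2,3,4) real_polynomial_function_minus real_polynomial_function_power)
  then show ?thesis by blast
qed

lemma ex1_reduced_bracket: "\<exists>!P. induced_bracket VH dirac_bracket Gam YH P"
proof (rule induced_bracket_ex1[OF dirac_bracket_poisson Gam_polynomial Gam_image(2)])
  fix b c :: "real^4" assume "b \<in> Basis" "c \<in> Basis"
  then obtain i j where "b = axis i 1" "c = axis j 1" by (auto simp: Basis_vec_real)
  then show "\<exists>\<pi>. real_polynomial_function \<pi> \<and>
      (\<forall>z\<in>VH. dirac_bracket (\<lambda>z\<in>VH. Gam z \<bullet> b) (\<lambda>z\<in>VH. Gam z \<bullet> c) z = \<pi> (Gam z))"
    using reduced_tensor_polynomial[of i j] dirac_bracket_Gam[of _ i j]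
    by (auto simp: inner_axis simp del: restrict_apply)
qed

lemma wcoord_in_ring: "wcoord i \<in> coord_ring YH"
  unfolding coord_def by (intro restrict_in_coord_ring polynomial_coordinate)

lemma induced_bracket_wcoord:
  assumes P: "induced_bracket VH dirac_bracket Gam YH P" and w: "w \<in> YH"
  shows "P (wcoord i) (wcoord j) w = reduced_tensor w $ i $ j"
proof -
  obtain z where z: "z \<in> VH" "w = Gam z" using w Gam_image(2) by blast
  have c: "compose VH (wcoord i) Gam = (\<lambda>z\<in>VH. Gam z $ i)" for i
    using Gam_VH_subset by (auto simp: compose_def coord_def inner_axis fun_eq_iff)
  have "dirac_bracket (compose VH (wcoord i) Gam) (compose VH (wcoord j) Gam) =
      compose VH (P (wcoord i) (wcoord j)) Gam"
    using P wcoord_in_ring by (simp add: induced_bracket_def)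
  then have "P (wcoord i) (wcoord j) (Gam z) = dirac_bracket (\<lambda>z\<in>VH. Gam z $ i) (\<lambda>z\<in>VH. Gam z $ j) z"
    using z(1) unfolding c by (simp add: compose_def del: restrict_apply) simp
  then show ?thesis using z dirac_bracket_Gam by simp
qed

lemma reduced_relations_tensor:
  assumes Q: "poisson_bracket YH Q"
  shows "reduced_relations Q \<longleftrightarrow> (\<forall>w\<in>YH. \<forall>i j. Q (wcoord i) (wcoord j) w = reduced_tensor w $ i $ j)"
proof -
  have "(\<forall>i j. Q (wcoord i) (wcoord j) w = reduced_tensor w $ i $ j) \<longleftrightarrow>
     Q (wcoord 1) (wcoord 2) w = 1 + (w$1)\<^sup>2 \<and>
     Q (wcoord 2) (wcoord 3) w = 2 * w$1 * w$3 \<and>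
     Q (wcoord 3) (wcoord 1) w = - 2 * w$2 \<and>
     Q (wcoord 1) (wcoord 4) w = 0 \<and>
     Q (wcoord 2) (wcoord 4) w = 0 \<and>
     Q (wcoord 3) (wcoord 4) w = 0" if w: "w \<in> YH" for w
  proof -
    have skew: "Q (wcoord i) (wcoord j) w = - Q (wcoord j) (wcoord i) w" for i j
      by (rule poisson_skew[OF Q wcoord_in_ring wcoord_in_ring w])
    have "Q (wcoord i) (wcoord i) w = 0" for i using skew[of i i] by simp
    then show ?thesis
      using skew[of 2 1] skew[of 3 2] skew[of 1 3] skew[of 4 1] skew[of 4 2] skew[of 4 3]
      unfolding forall_4 by (auto simp: reduced_tensor_def)
  qed
  then show ?thesis unfolding reduced_relations_def by blast
qed

lemma reduced_bracket_unique:
  assumes P: "poisson_bracket YH P" "reduced_relations P"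
    and Q: "poisson_bracket YH Q" "reduced_relations Q"
  shows "Q = P"
proof (rule poisson_bracket_unique[OF Q(1) P(1)])
  fix b c :: "real^4" and w assume "b \<in> Basis" "c \<in> Basis" "w \<in> YH"
  then show "Q (coord YH b) (coord YH c) w = P (coord YH b) (coord YH c) w"
    using P Q reduced_relations_tensor by (auto simp: Basis_vec_real)
qed

lemma induced_bracket_relations:
  assumes P: "induced_bracket VH dirac_bracket Gam YH P"
  shows "poisson_bracket YH P" "reduced_relations P"
proof -
  show "poisson_bracket YH P" using P by (simp add: induced_bracket_def)
  then show "reduced_relations P"
    using induced_bracket_wcoord[OF P] by (simp add: reduced_relations_tensor)
qed

section \<open>The equations of motion\<close>

text \<open>The right-hand side of the reduced system, with \<open>d\<close> in place of \<open>U' (w\<^sub>1)\<close>.\<close>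

definition reduced_field :: "real \<Rightarrow> real^4 \<Rightarrow> real^4" where
  "reduced_field d w = vector [w$2, w$1 * w$3 - (1 + (w$1)\<^sup>2) * d, - 2 * w$2 * d, 0]"

lemma reduced_field_tensor:
  "reduced_field d w $ i = 1/2 * reduced_tensor w $ i $ 3 + d * reduced_tensor w $ i $ 1"
proof -
  have "\<forall>i. reduced_field d w $ i = 1/2 * reduced_tensor w $ i $ 3 + d * reduced_tensor w $ i $ 1"
    unfolding forall_4 by (simp add: reduced_field_def reduced_tensor_def algebra_simps)
  then show ?thesis ..
qed

lemma h_red_has_derivative:
  assumes "(U has_real_derivative d) (at (w$1))"
  shows "(h_red U has_derivative (\<lambda>v. 1/2 * v$3 + d * v$1)) (at w)"
proof -
  have "((\<lambda>w. U (w$1)) has_derivative (\<lambda>v. d * v$1)) (at w)"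
    using has_derivative_compose[of "\<lambda>w. w$1" "\<lambda>v. v$1" w UNIV U "(*) d"] assms
    by (simp add: has_field_derivative_def bounded_linear_imp_has_derivative bounded_linear_vec_nth)
  then show ?thesis
    unfolding h_red_def
    by (intro has_derivative_add has_derivative_mult_right bounded_linear_imp_has_derivative bounded_linear_vec_nth)
qed

lemma reduced_smooth_bracket:
  assumes P: "induced_bracket VH dirac_bracket Gam YH P" and w: "w \<in> YH"
    and U: "(U has_real_derivative d) (at (w$1))"
  shows "smooth_bracket YH P (wcoord i) (h_red U) w = reduced_field d w $ i"
proof -
  have "smooth_bracket YH P (wcoord i) (h_red U) w =
      (\<Sum>j\<in>UNIV. reduced_tensor w $ i $ j * (1/2 * axis j 1 $ 3 + d * axis j 1 $ 1))"
    unfolding smooth_bracket_def Basis_vec_real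
    by (subst sum.reindex) (auto simp: inj_on_def axis_eq_axis induced_bracket_wcoord[OF P w]
        der_eqI[OF h_red_has_derivative[OF U]])
  also have "\<dots> = reduced_field d w $ i"
    by (simp add: sum_4 axis_def reduced_field_tensor)
  finally show ?thesis .
qed

lemma reduced_hamiltonian_field:
  assumes "induced_bracket VH dirac_bracket Gam YH P" "w \<in> YH"
    "(U has_real_derivative d) (at (w$1))"
  shows "hamiltonian_field YH P (h_red U) w = reduced_field d w"
proof -
  have "hamiltonian_field YH P (h_red U) w = (\<Sum>b\<in>Basis. (reduced_field d w \<bullet> b) *\<^sub>R b)"
    unfolding hamiltonian_field_def
    by (intro sum.cong refl) (auto simp: Basis_vec_real reduced_smooth_bracket[OF assms] inner_axis)
  then show ?thesis by (simp add: euclidean_representation)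
qed

lemma tau1_eq: "tau1 z = fst z $ 1"
  by (simp add: tau1_def split_beta)

lemma H_full_eq: "H_full U z = h_red U (Gam z)"
  by (simp add: H_full_def h_red_def tau1_def tau3_def lorentz_def power2_eq_square split: prod.split)

lemma H_full_has_gradient:
  assumes "(U has_real_derivative d) (at (fst z $ 1))"
  shows "(H_full U has_derivative
    (\<lambda>v. v \<bullet> ((1/2) *\<^sub>R Gam_grad z $ 3 + d *\<^sub>R Gam_grad z $ 1))) (at z)"
proof -
  have "((\<lambda>z. U (Gam z $ 1)) has_derivative (\<lambda>v. d * (v \<bullet> Gam_grad z $ 1))) (at z)"
    using has_derivative_compose[OF Gam_has_gradient[of 1 z], where g = U and g' = "(*) d"] assms
    by (simp add: has_field_derivative_def)
  then have "((\<lambda>z. 1/2 * Gam z $ 3 + U (Gam z $ 1)) has_derivative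
      (\<lambda>v. 1/2 * (v \<bullet> Gam_grad z $ 3) + d * (v \<bullet> Gam_grad z $ 1))) (at z)"
    by (intro has_derivative_add has_derivative_mult_right Gam_has_gradient)
  moreover have "H_full U = (\<lambda>z. 1/2 * Gam z $ 3 + U (Gam z $ 1))"
    by (simp add: H_full_eq h_red_def fun_eq_iff)
  ultimately show ?thesis by (simp add: inner_add_right)
qed

text \<open>The argument of \<open>dirac_field\<close> is the gradient of \<open>H = \<tau>\<^sub>3 / 2 + U (\<tau>\<^sub>1)\<close>. The sign appears because
  \<open>dirac_field\<close> has the gradient in the first slot of the bracket, whereas the equations of motion are
  \<open>z' = {z, H}\<close>.\<close>

lemma motion_field_dirac:
  assumes z: "z \<in> VH" and U: "(U has_real_derivative d) (at (fst z $ 1))"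
  shows "motion_field U z = - dirac_field ((1/2) *\<^sub>R Gam_grad z $ 3 + d *\<^sub>R Gam_grad z $ 1) z"
proof -
  obtain x y where xy: "z = (x, y)" by (cases z)
  have xy0: "lorentz x y = 0" using z xy by (simp add: VH_def)
  have "((\<lambda>x. U (x$1)) has_derivative (\<lambda>v. d * v$1)) (at x)"
    using has_derivative_compose[of "\<lambda>w. w$1" "\<lambda>v. v$1" x UNIV U "(*) d"] U xy
    by (simp add: has_field_derivative_def bounded_linear_imp_has_derivative bounded_linear_vec_nth)
  then have grad: "lorentz_gradient (\<lambda>x. U (x$1)) x = d *\<^sub>R axis 1 1"
    by (simp add: lorentz_gradient_def der_eqI vec_eq_iff forall_3 lorentz_metric_def axis_def)
  show ?thesis
    unfolding xy motion_field_def Let_def prod.case grad dirac_field_def Gam_grad_def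
    using xy0
    by (simp add: prod_eq_iff inner_lorentz_dual vec_eq_iff forall_3 lorentz_simps)
      (simp add: lorentz_def axis_def inner_vec_def sum_3 algebra_simps)
qed

text \<open>The left-hand side is \<open>{\<tau>\<^sub>i, H} = {\<tau>\<^sub>i, \<tau>\<^sub>3} / 2 + U' (\<tau>\<^sub>1) {\<tau>\<^sub>i, \<tau>\<^sub>1}\<close>, a combination of
  brackets of components of \<open>Gam\<close>.\<close>

lemma motion_field_maps_to_reduced:
  assumes z: "z \<in> VH" and U: "(U has_real_derivative d) (at (fst z $ 1))"
  shows "motion_field U z \<bullet> Gam_grad z $ i = reduced_field d (Gam z) $ i"
proof -
  have "motion_field U z \<bullet> Gam_grad z $ i =
      dirac_field (Gam_grad z $ i) z \<bullet> ((1/2) *\<^sub>R Gam_grad z $ 3 + d *\<^sub>R Gam_grad z $ 1)"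
    unfolding motion_field_dirac[OF assms] inner_minus_left
    using dirac_field_skew[of "Gam_grad z $ i" z] by simp
  then show ?thesis
    by (simp add: inner_add_right dirac_field_Gam_grad[OF z] reduced_field_tensor)
qed

lemma rat_fun_has_derivative:
  assumes "t \<in> rat_dom q"
  shows "(rat_fun p q has_real_derivative deriv (rat_fun p q) t) (at t)"
proof -
  have "rat_fun p q field_differentiable (at t)"
    using assms unfolding rat_fun_def rat_dom_def
    by (auto simp: field_differentiable_def intro!: derivative_eq_intros exI)
  then show ?thesis by (simp add: DERIV_deriv_iff_field_differentiable)
qed

lemma constant_along_solutions:
  assumes I: "\<And>w. w \<in> M \<Longrightarrow> (I has_derivative I' w) (at w)" "\<And>w. w \<in> M \<Longrightarrow> I' w (F w) = 0"
  shows "first_integral F M I"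
  unfolding first_integral_def
proof (intro allI impI)
  fix T c assume sol: "solution_on F M T c"
  have "((I \<circ> c) has_vector_derivative 0) (at t within T)" if "t \<in> T" for t
  proof -
    have c: "c t \<in> M" "(c has_vector_derivative F (c t)) (at t)"
      using sol that by (auto simp: solution_on_def)
    have "((\<lambda>t. I (c t)) has_derivative (\<lambda>h. I' (c t) (h *\<^sub>R F (c t)))) (at t)"
      using has_derivative_compose[OF c(2)[unfolded has_vector_derivative_def] I(1)[OF c(1)]] .
    then have "((\<lambda>t. I (c t)) has_derivative (\<lambda>h. 0)) (at t)"
      using I(2)[OF c(1)] linear_cmul[OF has_derivative_linear[OF I(1)[OF c(1)]]] by simp
    then show ?thesis
      by (simp add: has_vector_derivative_def o_def has_derivative_at_withinI)
  qed
  moreover have "convex T" using sol by (simp add: solution_on_def is_interval_convex)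
  ultimately show "(I \<circ> c) constant_on T"
    using has_vector_derivative_zero_constant unfolding constant_on_def by metis
qed

lemma reduced_solution:
  assumes P: "induced_bracket VH dirac_bracket Gam YH P"
    and U: "\<And>t. t \<in> S \<Longrightarrow> (U has_real_derivative d t) (at t)"
    and sol: "solution_on (motion_field U) {z \<in> TH2. tau1 z \<in> S} T c"
  shows "solution_on (hamiltonian_field YH P (h_red U)) {w \<in> YH. w$1 \<in> S} T (Gam \<circ> c)"
  unfolding solution_on_def
proof (intro conjI ballI)
  show "open T" "is_interval T" using sol by (auto simp: solution_on_def)
  fix t assume t: "t \<in> T"
  let ?z = "c t"
  have z: "?z \<in> TH2" "fst ?z $ 1 \<in> S" and c': "(c has_vector_derivative motion_field U ?z) (at t)"
    using sol t by (auto simp: solution_on_def tau1_eq)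
  have zV: "?z \<in> VH" using z by (auto simp: TH2_def)
  then show wY: "(Gam \<circ> c) t \<in> {w \<in> YH. w$1 \<in> S}" using z Gam_VH_subset by auto
  have "((\<lambda>t. Gam (c t) $ i) has_vector_derivative reduced_field (d (fst ?z $ 1)) (Gam ?z) $ i) (at t)" for i
    using has_derivative_compose[OF c'[unfolded has_vector_derivative_def] Gam_has_gradient[of i ?z]]
      motion_field_maps_to_reduced[OF zV U[OF z(2)], of i]
    by (simp add: has_vector_derivative_def)
  then have "(Gam \<circ> c has_vector_derivative reduced_field (d (fst ?z $ 1)) (Gam ?z)) (at t)"
    unfolding has_vector_derivative_def
    by (subst has_derivative_componentwise_within) (auto simp: Basis_vec_real inner_axis)
  then show "(Gam \<circ> c has_vector_derivative hamiltonian_field YH P (h_red U) ((Gam \<circ> c) t)) (at t)"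
    using reduced_hamiltonian_field[OF P, of "Gam ?z" U] wY U[OF z(2)] by simp
qed

theorem proposition3p9:
  shows
    "(\<forall>z\<in>TH2. \<exists>A C. affine A \<and> aff_dim A = 2 \<and> C \<subseteq> A \<and> hyperbola C \<and>
        orbit_h z \<in> components C) \<and>
     Gam ` VH \<subseteq> YH \<and>
     (Gam ` TH2 = YH \<and> Gam ` VH = YH) \<and>
     ((\<exists>!P. induced_bracket VH dirac_bracket Gam YH P) \<and>
      (\<forall>P. induced_bracket VH dirac_bracket Gam YH P \<longrightarrow>
         reduced_relations P \<and>
         (\<forall>Q. poisson_bracket YH Q \<and> reduced_relations Q \<longrightarrow> Q = P))) \<and>
     (\<forall>P p q U.
      induced_bracket VH dirac_bracket Gam YH P \<and> q \<noteq> 0 \<and> U = rat_fun p q \<longrightarrow>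
        (\<forall>z\<in>TH2. tau1 z \<in> rat_dom q \<longrightarrow>
           hamiltonian_field VH dirac_bracket (H_full U) z = motion_field U z) \<and>
        (\<forall>T c. solution_on (motion_field U) {z \<in> TH2. tau1 z \<in> rat_dom q} T c \<longrightarrow>
           solution_on (hamiltonian_field YH P (h_red U)) {w \<in> YH. w$1 \<in> rat_dom q} T (Gam \<circ> c)) \<and>
        (\<forall>w\<in>YH. w$1 \<in> rat_dom q \<longrightarrow>
           smooth_bracket YH P (wcoord 1) (h_red U) w = w$2 \<and>
           smooth_bracket YH P (wcoord 2) (h_red U) w =
             w$1 * w$3 - (1 + (w$1)\<^sup>2) * deriv U (w$1) \<and>
           smooth_bracket YH P (wcoord 3) (h_red U) w = - 2 * w$2 * deriv U (w$1) \<and>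
           smooth_bracket YH P (wcoord 4) (h_red U) w = 0) \<and>
        first_integral (hamiltonian_field YH P (h_red U)) {w \<in> YH. w$1 \<in> rat_dom q} (h_red U) \<and>
        first_integral (hamiltonian_field YH P (h_red U)) {w \<in> YH. w$1 \<in> rat_dom q} (\<lambda>w. w$4))"
proof (intro conjI allI impI ballI; (elim conjE)?)
  fix z assume "z \<in> TH2"
  then show "\<exists>A C. affine A \<and> aff_dim A = 2 \<and> C \<subseteq> A \<and> hyperbola C \<and> orbit_h z \<in> components C"
    by (rule orbit_h_hyperbola_branch)
next
  show "Gam ` VH \<subseteq> YH" "Gam ` TH2 = YH" "Gam ` VH = YH"
    by (rule Gam_VH_subset Gam_image)+
next
  show "\<exists>!P. induced_bracket VH dirac_bracket Gam YH P" by (rule ex1_reduced_bracket)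
next
  fix P assume P: "induced_bracket VH dirac_bracket Gam YH P"
  note rel = induced_bracket_relations[OF P]
  show "reduced_relations P" by (rule rel)
  show "Q = P" if "poisson_bracket YH Q" "reduced_relations Q" for Q
    using reduced_bracket_unique[OF rel that] .
next
  fix P and p q :: "real poly" and U
  assume P: "induced_bracket VH dirac_bracket Gam YH P" and U: "U = rat_fun p q"
  have U': "(U has_real_derivative deriv U t) (at t)" if "t \<in> rat_dom q" for t
    using rat_fun_has_derivative[OF that] U by simp
  show "hamiltonian_field VH dirac_bracket (H_full U) z = motion_field U z"
    if "z \<in> TH2" "tau1 z \<in> rat_dom q" for z
  proof -
    have "fst z $ 1 \<in> rat_dom q" "z \<in> VH" using that by (auto simp: tau1_eq TH2_def)
    then show ?thesis
      using hamiltonian_field_dirac[OF H_full_has_gradient[OF U']] motion_field_dirac[OF _ U'] by simp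
  qed
  show "solution_on (hamiltonian_field YH P (h_red U)) {w \<in> YH. w$1 \<in> rat_dom q} T (Gam \<circ> c)"
    if "solution_on (motion_field U) {z \<in> TH2. tau1 z \<in> rat_dom q} T c" for T c
    using reduced_solution[OF P U' that] .
  show "smooth_bracket YH P (wcoord 1) (h_red U) w = w$2"
    "smooth_bracket YH P (wcoord 2) (h_red U) w = w$1 * w$3 - (1 + (w$1)\<^sup>2) * deriv U (w$1)"
    "smooth_bracket YH P (wcoord 3) (h_red U) w = - 2 * w$2 * deriv U (w$1)"
    "smooth_bracket YH P (wcoord 4) (h_red U) w = 0"
    if "w \<in> YH" "w$1 \<in> rat_dom q" for w
    using reduced_smooth_bracket[OF P that(1) U'[OF that(2)]] by (simp_all add: reduced_field_def)
  have field: "hamiltonian_field YH P (h_red U) w = reduced_field (deriv U (w$1)) w"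
    if "w \<in> {w \<in> YH. w$1 \<in> rat_dom q}" for w
    using reduced_hamiltonian_field[OF P _ U'] that by blast
  show "first_integral (hamiltonian_field YH P (h_red U)) {w \<in> YH. w$1 \<in> rat_dom q} (h_red U)"
    by (rule constant_along_solutions[OF h_red_has_derivative[OF U']])
      (auto simp: field reduced_field_def)
  show "first_integral (hamiltonian_field YH P (h_red U)) {w \<in> YH. w$1 \<in> rat_dom q} (\<lambda>w. w$4)"
    by (rule constant_along_solutions[OF bounded_linear_imp_has_derivative[OF bounded_linear_vec_nth]])
      (auto simp: field reduced_field_def)
qed

end
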